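(* For every $n \ge 2$, $$PVT_n \cong U_n \rtimes (U_{n-1} \rtimes (\cdots \rtimes (U_4 \rtimes (U_3 \rtimes U_2))\cdots)),$$ where $U_2 = PVT_2 \cong \mathbb{Z}$ and, for $i \ge 3$, $U_i = \ker(f_i : PVT_i \to PVT_{i-1})$ is an infinitely generated free group (that is, a free group of infinite rank).
   Context: For $n\ge 2$, the virtual twin group $VT_n$ is the group with generators $s_1,\dots,s_{n-1},\rho_1,\dots,\rho_{n-1}$ and defining relations: $s_i^2=1$ and $\rho_i^2=1$ for $1\le i\le n-1$; $s_is_j=s_js_i$, $\rho_i\rho_j=\rho_j\rho_i$ and $\rho_is_j=s_j\rho_i$ for $|i-j|\ge 2$; $\rho_i\rho_{i+1}\rho_i=\rho_{i+1}\rho_i\rho_{i+1}$ and $\rho_i\rho_{i+1}s_i=s_{i+1}\rho_i\rho_{i+1}$ for $1\le i\le n-2$. The pure virtual twin group $PVT_n$ is the kernel of the surjection $\pi:VT_n\to S_n$, $\pi(s_i)=\pi(\rho_i)=(i,i+1)$. Put $\lambda_{i,i+1}=s_i\rho_i$, and for $1\le i<j\le n$ with $j\ne i+1$ put $\lambda_{i,j}=\rho_{j-1}\cdots\rho_{i+1}\,\lambda_{i,i+1}\,\rho_{i+1}\cdots\rho_{j-1}$. The group $PVT_n$ has the presentation with generators $\lambda_{i,j}$ ($1\le i<j\le n$) and relations $\lambda_{i,j}\lambda_{k,l}=\lambda_{k,l}\lambda_{i,j}$ for pairwise distinct $i,j,k,l$. For $n\ge 3$, the homomorphism $f_n:PVT_n\to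 PVT_{n-1}$ is defined on generators by $f_n(\lambda_{i,j})=\lambda_{i,j}$ if $j\ne n$ and $f_n(\lambda_{i,n})=1$ (geometrically, it removes the $n$-th strand). It is split by the natural inclusion $i_n:PVT_{n-1}\to PVT_n$, $\lambda_{i,j}\mapsto\lambda_{i,j}$; the semidirect products in the statement come from the resulting decompositions $PVT_m\cong U_m\rtimes PVT_{m-1}$. *)

theory Defs
  imports "HOL-Algebra.Elementary_Groups" "HOL-Algebra.Sym_Groups" "HOL-Algebra.Bij"
begin

section \<open>Groups given by generators and relations\<close>

text \<open>
  Words are lists of signed letters: \<open>(x, True)\<close> stands for \<open>x\<close> and \<open>(x, False)\<close> for its
  inverse. A relation \<open>u = v\<close> is the pair \<open>(u, v)\<close>.
\<close>

type_synonym 'g word = "('g \<times> bool) list"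

inductive pres_cong :: "'g set \<Rightarrow> ('g word \<times> 'g word) set \<Rightarrow> 'g word \<Rightarrow> 'g word \<Rightarrow> bool"
  for X :: "'g set" and R :: "('g word \<times> 'g word) set"
  where
    refl: "set w \<subseteq> X \<times> UNIV \<Longrightarrow> pres_cong X R w w"
  | sym: "pres_cong X R u v \<Longrightarrow> pres_cong X R v u"
  | trans: "pres_cong X R u v \<Longrightarrow> pres_cong X R v w \<Longrightarrow> pres_cong X R u w"
  | mult: "pres_cong X R u u' \<Longrightarrow> pres_cong X R v v' \<Longrightarrow> pres_cong X R (u @ v) (u' @ v')"
  | cancel: "x \<in> X \<Longrightarrow> pres_cong X R [(x, b), (x, \<not> b)] []"
  | rel: "(u, v) \<in> R \<Longrightarrow> pres_cong X R u v"

definition pres_class :: "'g set \<Rightarrow> ('g word \<times> 'g word) set \<Rightarrow> 'g word \<Rightarrow> 'g word set"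
  where "pres_class X R w = {w'. pres_cong X R w w'}"

definition presented_group :: "'g set \<Rightarrow> ('g word \<times> 'g word) set \<Rightarrow> 'g word set monoid"
  where "presented_group X R =
    \<lparr>carrier = pres_class X R ` {w. set w \<subseteq> X \<times> UNIV},
     monoid.mult = (\<lambda>A B. {w. \<exists>u\<in>A. \<exists>v\<in>B. pres_cong X R (u @ v) w}),
     one = pres_class X R []\<rparr>"

lemma pres_class_eq: "pres_cong X R u v \<Longrightarrow> pres_class X R u = pres_class X R v"
  unfolding pres_class_def by (auto intro: pres_cong.sym pres_cong.trans)

lemma pres_class_mult:
  assumes "set u \<subseteq> X \<times> UNIV" "set v \<subseteq> X \<times> UNIV"
  shows "pres_class X R u \<otimes>\<^bsub>presented_group X R\<^esub> pres_class X R v = pres_class X R (u @ v)"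
proof -
  have "pres_cong X R u u" "pres_cong X R v v"
    using assms by (auto intro: pres_cong.refl)
  then show ?thesis
    unfolding presented_group_def pres_class_def
    by (auto intro: pres_cong.mult pres_cong.trans)
qed

lemma pres_cong_inverse:
  "set w \<subseteq> X \<times> UNIV \<Longrightarrow> pres_cong X R (rev (map (\<lambda>(x, b). (x, \<not> b)) w) @ w) []"
proof (induction w)
  case Nil
  then show ?case by (simp add: pres_cong.refl)
next
  case (Cons a w)
  obtain x b where a: "a = (x, b)" by (cases a)
  let ?i = "rev (map (\<lambda>(x, b). (x, \<not> b)) w)"
  have w: "set w \<subseteq> X \<times> UNIV" and x: "x \<in> X" using Cons.prems a by auto
  have i: "set ?i \<subseteq> X \<times> UNIV" using w by auto
  have "pres_cong X R ([(x, \<not> b), (x, b)] @ w) ([] @ w)"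
    using pres_cong.mult[OF pres_cong.cancel[OF x, of R "\<not> b"] pres_cong.refl[OF w]] by simp
  then have "pres_cong X R (?i @ ([(x, \<not> b), (x, b)] @ w)) (?i @ ([] @ w))"
    using pres_cong.mult[OF pres_cong.refl[OF i]] by blast
  then show ?case
    using Cons.IH[OF w] a by (auto intro: pres_cong.trans)
qed

lemma group_presented_group: "group (presented_group X R)"
proof (rule groupI)
  let ?G = "presented_group X R"
  have car: "carrier ?G = pres_class X R ` {w. set w \<subseteq> X \<times> UNIV}"
    and one: "\<one>\<^bsub>?G\<^esub> = pres_class X R []"
    by (simp_all add: presented_group_def)
  show "\<one>\<^bsub>?G\<^esub> \<in> carrier ?G" unfolding car one by auto
  fix a assume "a \<in> carrier ?G"
  then obtain u where u: "a = pres_class X R u" "set u \<subseteq> X \<times> UNIV" by (auto simp: car)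
  show "\<one>\<^bsub>?G\<^esub> \<otimes>\<^bsub>?G\<^esub> a = a" using u by (simp add: one pres_class_mult)
  have i: "set (rev (map (\<lambda>(x, b). (x, \<not> b)) u)) \<subseteq> X \<times> UNIV" using u by auto
  show "\<exists>y\<in>carrier ?G. y \<otimes>\<^bsub>?G\<^esub> a = \<one>\<^bsub>?G\<^esub>"
  proof
    show "pres_class X R (rev (map (\<lambda>(x, b). (x, \<not> b)) u)) \<otimes>\<^bsub>?G\<^esub> a = \<one>\<^bsub>?G\<^esub>"
      using pres_class_eq[OF pres_cong_inverse[OF u(2)]] pres_class_mult[OF i u(2)]
      by (simp add: one u(1))
    show "pres_class X R (rev (map (\<lambda>(x, b). (x, \<not> b)) u)) \<in> carrier ?G"
      using i by (auto simp: car)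
  qed
  fix b assume "b \<in> carrier ?G"
  then obtain v where v: "b = pres_class X R v" "set v \<subseteq> X \<times> UNIV" by (auto simp: car)
  show "a \<otimes>\<^bsub>?G\<^esub> b \<in> carrier ?G"
    using u v by (auto simp: pres_class_mult car)
  fix c assume "c \<in> carrier ?G"
  then obtain w where w: "c = pres_class X R w" "set w \<subseteq> X \<times> UNIV" by (auto simp: car)
  show "a \<otimes>\<^bsub>?G\<^esub> b \<otimes>\<^bsub>?G\<^esub> c = a \<otimes>\<^bsub>?G\<^esub> (b \<otimes>\<^bsub>?G\<^esub> c)"
    using u v w by (simp add: pres_class_mult)
qed

text \<open>
  The homomorphism from \<open>G\<close> to \<open>H\<close> that sends the generator \<open>x i\<close> to \<open>y i\<close> for all \<open>i\<close> in \<open>I\<close>.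
  Extensionality makes it unique as a HOL function when the \<open>x i\<close> generate \<open>G\<close>.
\<close>

definition hom_on_gens ::
    "('a, 'c) monoid_scheme \<Rightarrow> ('b, 'd) monoid_scheme \<Rightarrow> 'i set \<Rightarrow> ('i \<Rightarrow> 'a) \<Rightarrow> ('i \<Rightarrow> 'b) \<Rightarrow> 'a \<Rightarrow> 'b"
  where "hom_on_gens G H I x y =
    (THE h. h \<in> hom G H \<and> h \<in> extensional (carrier G) \<and> (\<forall>i\<in>I. h (x i) = y i))"

definition free_group :: "'g set \<Rightarrow> 'g word set monoid"
  where "free_group X = presented_group X {}"

definition free_basis :: "('a, 'c) monoid_scheme \<Rightarrow> 'a set \<Rightarrow> bool"
  where "free_basis G B \<longleftrightarrow> B \<subseteq> carrier G \<and>
    (\<exists>h \<in> iso (free_group B) G. \<forall>b\<in>B. h (pres_class B {} [(b, True)]) = b)"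

definition free_of_infinite_rank :: "('a, 'c) monoid_scheme \<Rightarrow> bool"
  where "free_of_infinite_rank G \<longleftrightarrow> group G \<and> (\<exists>B. free_basis G B \<and> infinite B)"


section \<open>Virtual twin groups\<close>

datatype vt_gen = Sg nat | Rg nat

abbreviation sg :: "nat \<Rightarrow> vt_gen \<times> bool" where "sg i \<equiv> (Sg i, True)"
abbreviation rg :: "nat \<Rightarrow> vt_gen \<times> bool" where "rg i \<equiv> (Rg i, True)"

type_synonym vt_elem = "vt_gen word set"

definition VT_gens :: "nat \<Rightarrow> vt_gen set"
  where "VT_gens n = Sg ` {1..n - 1} \<union> Rg ` {1..n - 1}"

definition VT_rels :: "nat \<Rightarrow> (vt_gen word \<times> vt_gen word) set"
  where "VT_rels n =
      {([sg i, sg i], []) | i. i \<in> {1..n - 1}}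
    \<union> {([rg i, rg i], []) | i. i \<in> {1..n - 1}}
    \<union> {([sg i, sg j], [sg j, sg i]) | i j.
         i \<in> {1..n - 1} \<and> j \<in> {1..n - 1} \<and> \<bar>int i - int j\<bar> \<ge> 2}
    \<union> {([rg i, rg j], [rg j, rg i]) | i j.
         i \<in> {1..n - 1} \<and> j \<in> {1..n - 1} \<and> \<bar>int i - int j\<bar> \<ge> 2}
    \<union> {([rg i, sg j], [sg j, rg i]) | i j.
         i \<in> {1..n - 1} \<and> j \<in> {1..n - 1} \<and> \<bar>int i - int j\<bar> \<ge> 2}
    \<union> {([rg i, rg (i + 1), rg i], [rg (i + 1), rg i, rg (i + 1)]) | i. i \<in> {1..n - 2}}
    \<union> {([rg i, rg (i + 1), sg i], [sg (i + 1), rg i, rg (i + 1)]) | i. i \<in> {1..n - 2}}"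

definition VT :: "nat \<Rightarrow> vt_elem monoid"
  where "VT n = presented_group (VT_gens n) (VT_rels n)"

definition VT_class :: "nat \<Rightarrow> vt_gen word \<Rightarrow> vt_elem"
  where "VT_class n w = pres_class (VT_gens n) (VT_rels n) w"

fun gen_transposition :: "vt_gen \<Rightarrow> nat \<Rightarrow> nat"
  where
    "gen_transposition (Sg i) = transpose i (i + 1)"
  | "gen_transposition (Rg i) = transpose i (i + 1)"

definition VT_perm :: "nat \<Rightarrow> vt_elem \<Rightarrow> nat \<Rightarrow> nat"
  where "VT_perm n = hom_on_gens (VT n) (sym_group n) (VT_gens n)
    (\<lambda>x. VT_class n [(x, True)]) gen_transposition"

definition PVT :: "nat \<Rightarrow> vt_elem monoid"
  where "PVT n = (VT n)\<lparr>carrier := kernel (VT n) (sym_group n) (VT_perm n)\<rparr>"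

text \<open>
  The two cases \<open>j = i + 1\<close> and \<open>j > i + 1\<close> of the definition of \<open>\<lambda>\<^sub>i\<^sub>j\<close> are covered by one formula,
  since \<open>[i + 1..<j]\<close> is empty in the first case.
\<close>

definition lam :: "nat \<Rightarrow> nat \<times> nat \<Rightarrow> vt_elem"
  where "lam n = (\<lambda>(i, j). VT_class n
    (rev (map rg [i + 1..<j]) @ [sg i, rg i] @ map rg [i + 1..<j]))"

definition strand_pairs :: "nat \<Rightarrow> (nat \<times> nat) set"
  where "strand_pairs n = {(i, j). 1 \<le> i \<and> i < j \<and> j \<le> n}"

definition forget_strand :: "nat \<Rightarrow> vt_elem \<Rightarrow> vt_elem"
  where "forget_strand n = hom_on_gens (PVT n) (PVT (n - 1)) (strand_pairs n) (lam n)
    (\<lambda>(i, j). if j \<noteq> n then lam (n - 1) (i, j) else \<one>\<^bsub>PVT (n - 1)\<^esub>)"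

definition add_strand :: "nat \<Rightarrow> vt_elem \<Rightarrow> vt_elem"
  where "add_strand n = hom_on_gens (PVT (n - 1)) (PVT n) (strand_pairs (n - 1)) (lam (n - 1)) (lam n)"

definition U :: "nat \<Rightarrow> vt_elem monoid"
  where "U n = (if n = 2 then PVT 2
    else (PVT n)\<lparr>carrier := kernel (PVT n) (PVT (n - 1)) (forget_strand n)\<rparr>)"


section \<open>Iterated semidirect products\<close>

text \<open>
  External semidirect product of \<open>N\<close> by \<open>H\<close> along an action \<open>\<phi>\<close> of \<open>H\<close> on \<open>N\<close>. The pair of \<open>u\<close> and
  \<open>h\<close> is encoded as the list \<open>u # h\<close>, because iterating an ordinary product would give types that
  depend on the number of factors.
\<close>

definition semidirect ::
    "('a, 'c) monoid_scheme \<Rightarrow> ('a list, 'd) monoid_scheme \<Rightarrow> ('a list \<Rightarrow> 'a \<Rightarrow> 'a) \<Rightarrow> 'a list monoid"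
  where "semidirect N H \<phi> =
    \<lparr>carrier = {u # h | u h. u \<in> carrier N \<and> h \<in> carrier H},
     monoid.mult = (\<lambda>x y. (hd x \<otimes>\<^bsub>N\<^esub> \<phi> (tl x) (hd y)) # (tl x \<otimes>\<^bsub>H\<^esub> tl y)),
     one = \<one>\<^bsub>N\<^esub> # \<one>\<^bsub>H\<^esub>\<rparr>"

definition singleton_copy :: "('a, 'c) monoid_scheme \<Rightarrow> 'a list monoid"
  where "singleton_copy G =
    \<lparr>carrier = {[u] | u. u \<in> carrier G},
     monoid.mult = (\<lambda>x y. [hd x \<otimes>\<^bsub>G\<^esub> hd y]),
     one = [\<one>\<^bsub>G\<^esub>]\<rparr>"

text \<open>
  The element of \<open>PVT\<^sub>m\<close> represented by \<open>[u\<^sub>m, \<dots>, u\<^sub>2]\<close>, where \<open>u\<^sub>i\<close> lies in \<open>U\<^sub>i\<close>, under the repeated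
  decomposition of \<open>PVT\<^sub>m\<close> as the product of \<open>U\<^sub>m\<close> and the included copy of \<open>PVT\<^sub>m\<^sub>-\<^sub>1\<close>.
\<close>

fun decomp_eval :: "nat \<Rightarrow> vt_elem list \<Rightarrow> vt_elem"
  where
    "decomp_eval m [] = \<one>\<^bsub>PVT m\<^esub>"
  | "decomp_eval m (u # us) =
      (if m \<le> 2 then u else u \<otimes>\<^bsub>PVT m\<^esub> add_strand m (decomp_eval (m - 1) us))"

text \<open>
  The action on \<open>U\<^sub>m\<close> belonging to the split extension of \<open>PVT\<^sub>m\<^sub>-\<^sub>1\<close> by \<open>U\<^sub>m\<close>: conjugation in \<open>PVT\<^sub>m\<close> by
  the included copy of \<open>PVT\<^sub>m\<^sub>-\<^sub>1\<close>.
\<close>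

definition conj_action :: "nat \<Rightarrow> vt_elem list \<Rightarrow> vt_elem \<Rightarrow> vt_elem"
  where "conj_action m us = (\<lambda>u \<in> carrier (U m).
    add_strand m (decomp_eval (m - 1) us) \<otimes>\<^bsub>PVT m\<^esub> u
      \<otimes>\<^bsub>PVT m\<^esub> inv\<^bsub>PVT m\<^esub> (add_strand m (decomp_eval (m - 1) us)))"

text \<open>
  The group \<open>U\<^sub>m \<rtimes> (U\<^sub>m\<^sub>-\<^sub>1 \<rtimes> (\<dots> \<rtimes> U\<^sub>2))\<close>; only \<open>m \<ge> 2\<close> is meaningful.
\<close>

fun iterated_semidirect :: "nat \<Rightarrow> vt_elem list monoid"
  where "iterated_semidirect m =
    (if m \<le> 2 then singleton_copy (U 2)
     else semidirect (U m) (iterated_semidirect (m - 1)) (conj_action m))"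

declare iterated_semidirect.simps [simp del]

end

theory Submission
  imports Defs
begin

text \<open>
  Conjugation by \<open>\<rho>\<^sub>k\<close> sends \<open>\<lambda>\<^sub>i\<^sub>j\<close> to the \<open>\<lambda>\<close> whose indices are moved by \<open>(k, k + 1)\<close>, provided
  \<open>\<lambda>\<^sub>j\<^sub>i\<close> is read as the inverse of \<open>\<lambda>\<^sub>i\<^sub>j\<close> (\<open>conj_Lam\<close>). Since \<open>s\<^sub>i = \<lambda>\<^sub>i\<^sub>,\<^sub>i\<^sub>+\<^sub>1 \<rho>\<^sub>i\<close>, every element of
  \<open>VT\<^sub>n\<close> is therefore a product of \<open>\<lambda>\<close>s times a word in the \<open>\<rho>\<^sub>i\<close>. A word in the \<open>\<rho>\<^sub>i\<close> with trivial
  permutation is trivial, because the Coxeter relations present the symmetric group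
  (\<open>coxeter_faithful\<close>). So the \<open>\<lambda>\<^sub>i\<^sub>j\<close> generate \<open>PVT\<^sub>n\<close>. They satisfy no relations besides the
  commutation of \<open>\<lambda>\<close>s with disjoint indices: if \<open>A\<close> is the right-angled Artin group that these
  relations define, then \<open>s\<^sub>i \<mapsto> (\<lambda>\<^sub>i\<^sub>,\<^sub>i\<^sub>+\<^sub>1, (i, i + 1))\<close> and \<open>\<rho>\<^sub>i \<mapsto> (1, (i, i + 1))\<close> define a
  homomorphism from \<open>VT\<^sub>n\<close> to \<open>A \<rtimes> S\<^sub>n\<close> that sends \<open>\<lambda>\<^sub>i\<^sub>j\<close> to the generator of \<open>A\<close> with the same name
  (\<open>PVT_iso_raag\<close>).

  With this presentation, forgetting the last strand and adding one are homomorphisms, and the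
  first undoes the second. Thus \<open>PVT\<^sub>m\<close> is the semidirect product of \<open>U\<^sub>m\<close> by \<open>PVT\<^sub>m\<^sub>-\<^sub>1\<close>, and induction on
  \<open>m\<close> gives the iterated decomposition (\<open>decomp_eval_iso\<close>).

  The kernel \<open>U\<^sub>n\<close> is generated by the set \<open>B\<close> of all \<open>g \<lambda>\<^sub>i\<^sub>n g\<^sup>-\<^sup>1\<close> with \<open>g\<close> in \<open>PVT\<^sub>n\<^sub>-\<^sub>1\<close>. This group acts on
  \<open>B\<close> by conjugation, hence on the free group \<open>F\<close> over \<open>B\<close>. No relation involves two of the \<open>\<lambda>\<^sub>i\<^sub>n\<close>,
  and the relations that involve one of them say that certain \<open>\<lambda>\<^sub>k\<^sub>l\<close> fix it under conjugation, which
  holds for the letters of \<open>F\<close> by the choice of the action. So \<open>PVT\<^sub>n\<close> maps to \<open>F \<rtimes> PVT\<^sub>n\<^sub>-\<^sub>1\<close>, sending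
  every \<open>b\<close> in \<open>B\<close> to its letter, and therefore \<open>B\<close> is a free basis of \<open>U\<^sub>n\<close> (\<open>free_basis_kernel\<close>).
  Taking the set \<open>B\<close> itself as the alphabet, instead of cosets of the centralizers of the \<open>\<lambda>\<^sub>i\<^sub>n\<close>,
  avoids any normal form theorem for right-angled Artin groups. Finally, \<open>B\<close> is infinite for \<open>n \<ge> 3\<close>
  because a representation by permutations of the integers separates the elements
  \<open>\<lambda>\<^sub>1\<^sub>2\<^sup>m \<lambda>\<^sub>1\<^sub>n \<lambda>\<^sub>1\<^sub>2\<^sup>-\<^sup>m\<close> (\<open>infinite_strand_basis\<close>).
\<close>

section \<open>Homomorphisms out of presented groups\<close>

lemma (in group) inv_mult_cancel [simp]:
  assumes "x \<in> carrier G" "y \<in> carrier G"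
  shows "inv x \<otimes> (x \<otimes> y) = y" "x \<otimes> (inv x \<otimes> y) = y"
  using assms by (simp_all flip: m_assoc)

lemma (in group) commute_inv:
  assumes "x \<in> carrier G" "y \<in> carrier G" "x \<otimes> y = y \<otimes> x"
  shows "inv x \<otimes> y = y \<otimes> inv x"
proof -
  have "inv x \<otimes> y = inv x \<otimes> (y \<otimes> x) \<otimes> inv x" using assms(1,2) by (simp add: m_assoc)
  also have "\<dots> = y \<otimes> inv x" using assms(1,2) by (simp flip: assms(3) add: m_assoc)
  finally show ?thesis .
qed

lemma (in group) commute_mult:
  "x \<in> carrier G \<Longrightarrow> y \<in> carrier G \<Longrightarrow> z \<in> carrier G \<Longrightarrow> x \<otimes> y = y \<otimes> x \<Longrightarrow> x \<otimes> z = z \<otimes> x \<Longrightarrow>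
    x \<otimes> (y \<otimes> z) = (y \<otimes> z) \<otimes> x"
  by (metis m_assoc)

text \<open>
  Twice the braid relation turns the conjugation by \<open>aba\<close> into the conjugation by \<open>bab\<close>, whose
  inner \<open>b\<close> is absorbed by \<open>x\<close>.
\<close>

lemma (in group) conj_comm_braid:
  assumes "a \<in> carrier G" "b \<in> carrier G" "x \<in> carrier G"
    and "a \<otimes> b \<otimes> a = b \<otimes> a \<otimes> b" "b \<otimes> x = x \<otimes> b" "b \<otimes> b = \<one>"
  shows "a \<otimes> (b \<otimes> (a \<otimes> x \<otimes> a) \<otimes> b) \<otimes> a = b \<otimes> (a \<otimes> x \<otimes> a) \<otimes> b"
proof -
  have "a \<otimes> (b \<otimes> (a \<otimes> x \<otimes> a) \<otimes> b) \<otimes> a = (a \<otimes> b \<otimes> a) \<otimes> x \<otimes> (a \<otimes> b \<otimes> a)"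
    using assms(1-3) by (simp add: m_assoc)
  also have "\<dots> = b \<otimes> a \<otimes> (b \<otimes> x) \<otimes> b \<otimes> a \<otimes> b"
    using assms(1-3) by (simp add: assms(4) m_assoc)
  also have "\<dots> = b \<otimes> a \<otimes> x \<otimes> (b \<otimes> b) \<otimes> a \<otimes> b"
    using assms(1-3) unfolding assms(5) by (simp add: m_assoc)
  finally show ?thesis using assms(1-3,6) by (simp add: m_assoc)
qed

lemma (in group) conj_swap:
  assumes "a \<in> carrier G" "b \<in> carrier G" "x \<in> carrier G" "a \<otimes> b = b \<otimes> a"
  shows "a \<otimes> (b \<otimes> x \<otimes> b) \<otimes> a = b \<otimes> (a \<otimes> x \<otimes> a) \<otimes> b"
proof -
  have "a \<otimes> (b \<otimes> x \<otimes> b) \<otimes> a = (a \<otimes> b) \<otimes> x \<otimes> (b \<otimes> a)"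
    using assms(1-3) by (simp add: m_assoc)
  also have "\<dots> = (b \<otimes> a) \<otimes> x \<otimes> (a \<otimes> b)" by (simp add: assms(4))
  finally show ?thesis using assms(1-3) by (simp add: m_assoc)
qed

lemma (in group) restrict_in_hom: "h \<in> hom G H \<Longrightarrow> restrict h (carrier G) \<in> hom G H"
  by (auto simp: hom_def Pi_iff)

lemma hom_eq_on_generate:
  assumes "group G" "group H" "f \<in> hom G H" "g \<in> hom G H" "S \<subseteq> carrier G"
    and eq: "\<And>x. x \<in> S \<Longrightarrow> f x = g x" and x: "x \<in> generate G S"
  shows "f x = g x"
proof -
  interpret G: group G by fact
  interpret f: group_hom G H f using assms by (simp add: group_hom_def group_hom_axioms_def)
  interpret g: group_hom G H g using assms by (simp add: group_hom_def group_hom_axioms_def)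
  from x show ?thesis
  proof induction
    case (eng a b)
    then show ?case using G.generate_in_carrier[OF \<open>S \<subseteq> carrier G\<close>] by simp
  qed (use eq \<open>S \<subseteq> carrier G\<close> in auto)
qed

text \<open>
  Induction along a word in the generators that is built up by multiplication on the left. Unlike in
  the induction rule of \<open>generate\<close>, no product of two arbitrary elements has to be treated.
\<close>

lemma (in group) generate_left_induct [consumes 2, case_names one step]:
  assumes S: "S \<subseteq> carrier G" and x: "x \<in> generate G S"
    and one: "P \<one>"
    and step: "\<And>a s. a \<in> generate G S \<Longrightarrow> P a \<Longrightarrow> s \<in> S \<Longrightarrow> P (s \<otimes> a) \<and> P (inv s \<otimes> a)"
  shows "P x"
proof -
  have "a \<in> generate G S \<and> P a \<longrightarrow> P (x \<otimes> a)" for a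
    using x
  proof (induction arbitrary: a)
    case one
    then show ?case using generate_in_carrier[OF S] by auto
  next
    case (eng h k)
    then have "a \<in> generate G S \<and> P a \<longrightarrow> P (h \<otimes> (k \<otimes> a))" 
      by (simp add: generate.eng)
    then show ?case using eng generate_in_carrier[OF S] by (auto simp: m_assoc)
  qed (use step in auto)
  from this[of \<one>] show ?thesis
    using one generate_in_carrier[OF S x] by (simp add: generate.one)
qed

text \<open>
  Turns the definite description behind \<open>hom_on_gens\<close> into an actual homomorphism, once one with the
  prescribed values is known.
\<close>

lemma hom_on_gens_eq_restrict:
  assumes G: "group G" "group H" and gen: "x ` I \<subseteq> carrier G" "carrier G = generate G (x ` I)"
    and h: "h \<in> hom G H" "\<And>i. i \<in> I \<Longrightarrow> h (x i) = y i"
  shows "hom_on_gens G H I x y = restrict h (carrier G)"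
  unfolding hom_on_gens_def
proof (rule the_equality)
  interpret G: group G by fact
  have rh: "restrict h (carrier G) \<in> hom G H"
    using h(1) by (rule G.restrict_in_hom)
  then show "restrict h (carrier G) \<in> hom G H \<and> restrict h (carrier G) \<in> extensional (carrier G) \<and>
      (\<forall>i\<in>I. restrict h (carrier G) (x i) = y i)"
    using h(2) gen(1) by auto
  fix k assume k: "k \<in> hom G H \<and> k \<in> extensional (carrier G) \<and> (\<forall>i\<in>I. k (x i) = y i)"
  show "k = restrict h (carrier G)"
  proof (rule extensionalityI)
    fix a assume "a \<in> carrier G"
    then have "a \<in> generate G (x ` I)" by (subst gen(2)[symmetric])
    then show "k a = restrict h (carrier G) a"
    proof (rule hom_eq_on_generate[OF G _ rh gen(1), rotated 2])
      show "k \<in> hom G H" using k by simp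
      show "k b = restrict h (carrier G) b" if "b \<in> x ` I" for b
        using that k h(2) gen(1) by auto
    qed
  qed (use k in auto)
qed

fun word_val :: "('a, 'c) monoid_scheme \<Rightarrow> ('g \<Rightarrow> 'a) \<Rightarrow> 'g word \<Rightarrow> 'a"
  where
    "word_val G y [] = \<one>\<^bsub>G\<^esub>"
  | "word_val G y ((x, b) # w) = (if b then y x else inv\<^bsub>G\<^esub> (y x)) \<otimes>\<^bsub>G\<^esub> word_val G y w"

lemma (in group) word_val_closed:
  assumes "y \<in> X \<rightarrow> carrier G" "set w \<subseteq> X \<times> UNIV"
  shows "word_val G y w \<in> carrier G"
  using assms(2)
proof (induction w)
  case (Cons a w)
  then show ?case using assms(1) by (cases a) (auto simp: Pi_iff)
qed simp

lemma (in group) word_val_append: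
  assumes "y \<in> X \<rightarrow> carrier G" "set u \<subseteq> X \<times> UNIV" "set v \<subseteq> X \<times> UNIV"
  shows "word_val G y (u @ v) = word_val G y u \<otimes> word_val G y v"
  using assms(2)
proof (induction u)
  case (Cons a u)
  then show ?case
    using assms(1) word_val_closed[OF assms(1)] assms(3) by (cases a) (auto simp: m_assoc Pi_iff)
qed (simp add: word_val_closed[OF assms(1,3)])

locale presentation =
  fixes X :: "'g set" and R :: "('g word \<times> 'g word) set"
  assumes rels_over: "\<And>u v. (u, v) \<in> R \<Longrightarrow> set u \<subseteq> X \<times> UNIV \<and> set v \<subseteq> X \<times> UNIV"
begin

abbreviation letter :: "'g \<Rightarrow> 'g word set"
  where "letter x \<equiv> pres_class X R [(x, True)]"

lemma pres_cong_over:
  "pres_cong X R u v \<Longrightarrow> set u \<subseteq> X \<times> UNIV \<and> set v \<subseteq> X \<times> UNIV"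
  by (induction rule: pres_cong.induct) (auto dest: rels_over)

lemma pres_cong_word_val:
  assumes G: "group G" and y: "y \<in> X \<rightarrow> carrier G"
    and rels: "\<And>u v. (u, v) \<in> R \<Longrightarrow> word_val G y u = word_val G y v"
    and "pres_cong X R u v"
  shows "word_val G y u = word_val G y v"
  using assms(4)
proof induction
  case (mult u u' v v')
  then show ?case 
    by (simp add: group.word_val_append[OF G y] pres_cong_over)
next
  case (cancel x b)
  then have "y x \<in> carrier G" using y by auto
  then show ?case using G by (simp add: group.is_monoid group.r_inv group.l_inv)
qed (use rels in auto)

lemma carrier_presented: "carrier (presented_group X R) = pres_class X R ` {w. set w \<subseteq> X \<times> UNIV}"
  by (simp add: presented_group_def)

lemma one_presented: "\<one>\<^bsub>presented_group X R\<^esub> = pres_class X R []"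
  by (simp add: presented_group_def)

lemma letter_closed: "letter \<in> X \<rightarrow> carrier (presented_group X R)"
  by (auto simp: carrier_presented)

text \<open>
  The universal property of a presentation. Evaluating a word gives a well defined map on classes,
  since evaluation respects each rule of the congruence.
\<close>

lemma presented_hom_exists:
  assumes G: "group G" and y: "y \<in> X \<rightarrow> carrier G"
    and rels: "\<And>u v. (u, v) \<in> R \<Longrightarrow> word_val G y u = word_val G y v"
  obtains h where "h \<in> hom (presented_group X R) G" "\<And>x. x \<in> X \<Longrightarrow> h (letter x) = y x"
proof -
  define h where "h A = word_val G y (SOME w. w \<in> A)" for A
  have h: "h (pres_class X R w) = word_val G y w" if "set w \<subseteq> X \<times> UNIV" for w
  proof -
    have "w \<in> pres_class X R w" using that by (simp add: pres_class_def pres_cong.refl)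
    then have "(SOME v. v \<in> pres_class X R w) \<in> pres_class X R w" by (metis someI)
    then have "pres_cong X R w (SOME v. v \<in> pres_class X R w)" by (simp add: pres_class_def)
    then show ?thesis using pres_cong_word_val[OF G y rels] by (simp add: h_def)
  qed
  show thesis
  proof
    show "h \<in> hom (presented_group X R) G"
      by (rule homI) (auto simp: carrier_presented h group.word_val_closed[OF G y] pres_class_mult
          group.word_val_append[OF G y])
    show "h (letter x) = y x" if "x \<in> X" for x
      using that y G by (auto simp: h Pi_iff group.is_monoid)
  qed
qed

lemma inv_letter:
  assumes "x \<in> X"
  shows "inv\<^bsub>presented_group X R\<^esub> (letter x) = pres_class X R [(x, False)]"
proof (rule group.inv_equality[OF group_presented_group])
  show "pres_class X R [(x, False)] \<otimes>\<^bsub>presented_group X R\<^esub> letter x = \<one>\<^bsub>presented_group X R\<^esub>"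
    using assms pres_cong.cancel[OF assms, of R False]
    by (simp add: pres_class_mult one_presented pres_class_eq)
qed (use assms in \<open>auto simp: carrier_presented\<close>)

text \<open>
  Lets one leave words behind: a class is the value of its word in the presented group, so a relation
  of the presentation becomes an equation between products of letters.
\<close>

lemma pres_class_word_val:
  "set w \<subseteq> X \<times> UNIV \<Longrightarrow> pres_class X R w = word_val (presented_group X R) letter w"
proof (induction w)
  case (Cons a w)
  obtain x b where a: "a = (x, b)" by (cases a)
  have "pres_class X R ([a] @ w) = pres_class X R [a] \<otimes>\<^bsub>presented_group X R\<^esub> pres_class X R w"
    using Cons.prems by (subst pres_class_mult) auto
  then show ?case using Cons a by (cases b) (auto simp: inv_letter)
qed (simp add: one_presented)

lemma letter_rel:
  "(u, v) \<in> R \<Longrightarrow> word_val (presented_group X R) letter u = word_val (presented_group X R) letter v"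
proof -
  assume uv: "(u, v) \<in> R"
  note over = rels_over[OF uv]
  have "pres_class X R u = pres_class X R v"
    by (rule pres_class_eq[OF pres_cong.rel[OF uv]])
  then show ?thesis
    unfolding pres_class_word_val[OF conjunct1[OF over]] pres_class_word_val[OF conjunct2[OF over]] .
qed

lemma presented_generated: "carrier (presented_group X R) = generate (presented_group X R) (letter ` X)"
proof
  interpret P: group "presented_group X R" by (rule group_presented_group)
  have "word_val (presented_group X R) letter w \<in> generate (presented_group X R) (letter ` X)"
    if "set w \<subseteq> X \<times> UNIV" for w
    using that
  proof (induction w)
    case (Cons a w)
    then show ?case
      by (cases a) (auto intro!: generate.eng[OF generate.incl] generate.eng[OF generate.inv])
  qed (simp add: generate.one)
  then have "pres_class X R w \<in> generate (presented_group X R) (letter ` X)"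
    if "set w \<subseteq> X \<times> UNIV" for w
    using that pres_class_word_val[OF that] by (simp only:)
  then show "carrier (presented_group X R) \<subseteq> generate (presented_group X R) (letter ` X)"
    unfolding carrier_presented by (intro image_subsetI) simp
  show "generate (presented_group X R) (letter ` X) \<subseteq> carrier (presented_group X R)"
    by (rule P.generate_incl) (use letter_closed in auto)
qed

lemma presented_hom_eq:
  assumes "group G" "f \<in> hom (presented_group X R) G" "g \<in> hom (presented_group X R) G"
    and "\<And>x. x \<in> X \<Longrightarrow> f (letter x) = g (letter x)" and "a \<in> carrier (presented_group X R)"
  shows "f a = g a"
proof (rule hom_eq_on_generate[OF group_presented_group assms(1-3)])
  show "letter ` X \<subseteq> carrier (presented_group X R)" using letter_closed by auto
  show "a \<in> generate (presented_group X R) (letter ` X)" using assms(5) presented_generated by simp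
qed (use assms(4) in auto)

text \<open>
  To let a group act on a presented group it suffices to prescribe the images of the letters. Each
  side of an action law is a homomorphism, so the laws only have to be checked on letters.
\<close>

lemma presented_action_exists:
  fixes H :: "('h, 'm) monoid_scheme"
  assumes H: "group H"
    and ex: "\<And>g. g \<in> carrier H \<Longrightarrow>
      \<exists>\<phi>\<in>hom (presented_group X R) (presented_group X R). \<forall>x\<in>X. \<phi> (letter x) = y g x"
    and one: "\<And>x. x \<in> X \<Longrightarrow> y \<one>\<^bsub>H\<^esub> x = letter x"
    and mult: "\<And>g h \<phi> x. g \<in> carrier H \<Longrightarrow> h \<in> carrier H \<Longrightarrow> x \<in> X \<Longrightarrow>
      \<phi> \<in> hom (presented_group X R) (presented_group X R) \<Longrightarrow> (\<And>x. x \<in> X \<Longrightarrow> \<phi> (letter x) = y g x) \<Longrightarrow>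
      \<phi> (y h x) = y (g \<otimes>\<^bsub>H\<^esub> h) x"
  obtains \<phi> where "\<And>g. g \<in> carrier H \<Longrightarrow> \<phi> g \<in> hom (presented_group X R) (presented_group X R)"
    and "\<And>g x. g \<in> carrier H \<Longrightarrow> x \<in> X \<Longrightarrow> \<phi> g (letter x) = y g x"
    and "\<And>a. a \<in> carrier (presented_group X R) \<Longrightarrow> \<phi> \<one>\<^bsub>H\<^esub> a = a"
    and "\<And>g h a. g \<in> carrier H \<Longrightarrow> h \<in> carrier H \<Longrightarrow> a \<in> carrier (presented_group X R) \<Longrightarrow>
      \<phi> (g \<otimes>\<^bsub>H\<^esub> h) a = \<phi> g (\<phi> h a)"
proof -
  let ?P = "presented_group X R"
  interpret H: group H by fact
  note grp = group_presented_group[of X R]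
  from ex have "\<exists>\<phi>. \<forall>g\<in>carrier H. \<phi> g \<in> hom ?P ?P \<and> (\<forall>x\<in>X. \<phi> g (letter x) = y g x)"
    by (intro bchoice) (simp add: Bex_def)
  then obtain \<phi> where hom: "\<And>g. g \<in> carrier H \<Longrightarrow> \<phi> g \<in> hom ?P ?P"
    and val: "\<And>g x. g \<in> carrier H \<Longrightarrow> x \<in> X \<Longrightarrow> \<phi> g (letter x) = y g x" by auto
  show thesis
  proof
    fix a assume a: "a \<in> carrier ?P"
    have "\<phi> \<one>\<^bsub>H\<^esub> a = id a"
      by (rule presented_hom_eq[OF grp hom]) (auto simp: val one a hom_def)
    then show "\<phi> \<one>\<^bsub>H\<^esub> a = a" by simp
    fix g h assume g: "g \<in> carrier H" and h: "h \<in> carrier H"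
    have "\<phi> (g \<otimes>\<^bsub>H\<^esub> h) a = (\<phi> g \<circ> \<phi> h) a"
    proof (rule presented_hom_eq[OF grp hom _ _ a])
      show "\<phi> g \<circ> \<phi> h \<in> hom ?P ?P"
        using hom[OF g] hom[OF h] by (rule hom_compose[rotated])
      show "\<phi> (g \<otimes>\<^bsub>H\<^esub> h) (letter x) = (\<phi> g \<circ> \<phi> h) (letter x)" if "x \<in> X" for x
        using mult[OF g h that hom[OF g] val[OF g]] that g h by (simp add: val)
    qed (use g h in auto)
    then show "\<phi> (g \<otimes>\<^bsub>H\<^esub> h) a = \<phi> g (\<phi> h a)" by simp
  qed (use hom val in auto)
qed

end

section \<open>Semidirect products\<close>

text \<open>
  The semidirect product on pairs, for a normal factor and an acting group of unrelated types. It is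
  used as a target for homomorphisms that detect which relations hold.
\<close>

definition sdp :: "('a, 'c) monoid_scheme \<Rightarrow> ('h, 'd) monoid_scheme \<Rightarrow> ('h \<Rightarrow> 'a \<Rightarrow> 'a) \<Rightarrow> ('a \<times> 'h) monoid"
  where "sdp N H \<phi> =
    \<lparr>carrier = carrier N \<times> carrier H,
     monoid.mult = (\<lambda>(a, g) (b, h). (a \<otimes>\<^bsub>N\<^esub> \<phi> g b, g \<otimes>\<^bsub>H\<^esub> h)),
     one = (\<one>\<^bsub>N\<^esub>, \<one>\<^bsub>H\<^esub>)\<rparr>"

lemma sdp_simps [simp]:
  "carrier (sdp N H \<phi>) = carrier N \<times> carrier H"
  "(a, g) \<otimes>\<^bsub>sdp N H \<phi>\<^esub> (b, h) = (a \<otimes>\<^bsub>N\<^esub> \<phi> g b, g \<otimes>\<^bsub>H\<^esub> h)"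
  "\<one>\<^bsub>sdp N H \<phi>\<^esub> = (\<one>\<^bsub>N\<^esub>, \<one>\<^bsub>H\<^esub>)"
  by (simp_all add: sdp_def)

locale group_action_by_homs = N: group N + H: group H
  for N :: "('a, 'c) monoid_scheme" (structure) and H :: "('h, 'd) monoid_scheme" (structure) +
  fixes \<phi> :: "'h \<Rightarrow> 'a \<Rightarrow> 'a"
  assumes act_hom: "g \<in> carrier H \<Longrightarrow> \<phi> g \<in> hom N N"
    and act_one: "a \<in> carrier N \<Longrightarrow> \<phi> \<one>\<^bsub>H\<^esub> a = a"
    and act_mult: "g \<in> carrier H \<Longrightarrow> h \<in> carrier H \<Longrightarrow> a \<in> carrier N \<Longrightarrow>
      \<phi> (g \<otimes>\<^bsub>H\<^esub> h) a = \<phi> g (\<phi> h a)"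
begin

lemma act_closed [simp]: "g \<in> carrier H \<Longrightarrow> a \<in> carrier N \<Longrightarrow> \<phi> g a \<in> carrier N"
  using act_hom[of g] by (auto simp: hom_def)

lemma act_prod [simp]:
  "g \<in> carrier H \<Longrightarrow> a \<in> carrier N \<Longrightarrow> b \<in> carrier N \<Longrightarrow>
    \<phi> g (a \<otimes>\<^bsub>N\<^esub> b) = \<phi> g a \<otimes>\<^bsub>N\<^esub> \<phi> g b"
  using act_hom[of g] by (auto simp: hom_def)

lemma act_unit [simp]: "g \<in> carrier H \<Longrightarrow> \<phi> g \<one>\<^bsub>N\<^esub> = \<one>\<^bsub>N\<^esub>"
  using act_hom[of g] hom_one[of "\<phi> g" N N] N.group_axioms by auto

lemma group_sdp: "group (sdp N H \<phi>)"
proof (rule groupI)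
  fix x assume x: "x \<in> carrier (sdp N H \<phi>)"
  obtain a g where xe: "x = (a, g)" by (cases x)
  have "(\<phi> (inv\<^bsub>H\<^esub> g) (inv\<^bsub>N\<^esub> a), inv\<^bsub>H\<^esub> g) \<in> carrier (sdp N H \<phi>)" using x xe by auto
  moreover have "(\<phi> (inv\<^bsub>H\<^esub> g) (inv\<^bsub>N\<^esub> a), inv\<^bsub>H\<^esub> g) \<otimes>\<^bsub>sdp N H \<phi>\<^esub> x = \<one>\<^bsub>sdp N H \<phi>\<^esub>"
    using x xe by (simp flip: act_prod)
  ultimately show "\<exists>y\<in>carrier (sdp N H \<phi>). y \<otimes>\<^bsub>sdp N H \<phi>\<^esub> x = \<one>\<^bsub>sdp N H \<phi>\<^esub>" by blast
qed (auto simp: act_one act_mult N.m_assoc H.m_assoc)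

lemma sdp_incl_fst: "(\<lambda>a. (a, \<one>\<^bsub>H\<^esub>)) \<in> hom N (sdp N H \<phi>)"
  by (auto simp: hom_def act_one)

lemma sdp_incl_snd: "(\<lambda>g. (\<one>\<^bsub>N\<^esub>, g)) \<in> hom H (sdp N H \<phi>)"
  by (auto simp: hom_def)

end

section \<open>Faithfulness of the Coxeter presentation of the symmetric group\<close>

locale coxeter_system = group G for G (structure) +
  fixes n :: nat and r :: "nat \<Rightarrow> 'a"
  assumes r_closed [simp]: "1 \<le> i \<Longrightarrow> i < n \<Longrightarrow> r i \<in> carrier G"
    and r_square [simp]: "1 \<le> i \<Longrightarrow> i < n \<Longrightarrow> r i \<otimes> r i = \<one>"
    and r_commute: "1 \<le> i \<Longrightarrow> i < n \<Longrightarrow> 1 \<le> j \<Longrightarrow> j < n \<Longrightarrow> i + 2 \<le> j \<or> j + 2 \<le> i \<Longrightarrow>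
      r i \<otimes> r j = r j \<otimes> r i"
    and r_braid: "1 \<le> i \<Longrightarrow> i + 1 < n \<Longrightarrow> r i \<otimes> r (i + 1) \<otimes> r i = r (i + 1) \<otimes> r i \<otimes> r (i + 1)"
begin

lemma r_cancel [simp]: "1 \<le> i \<Longrightarrow> i < n \<Longrightarrow> x \<in> carrier G \<Longrightarrow> r i \<otimes> (r i \<otimes> x) = x"
  by (simp flip: m_assoc)

lemma inv_r [simp]: "1 \<le> i \<Longrightarrow> i < n \<Longrightarrow> inv (r i) = r i"
  by (rule inv_equality) auto

lemma r_closed_image: "m \<le> n \<Longrightarrow> r ` {1..<m} \<subseteq> carrier G"
  by auto

text \<open>
  The product \<open>r\<^sub>k r\<^sub>k\<^sub>+\<^sub>1 \<dots> r\<^sub>m\<^sub>-\<^sub>1\<close>. Its permutation sends \<open>m\<close> to \<open>k\<close>, so these elements represent the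
  cosets of the stabilizer of \<open>m\<close> in the symmetric group on \<open>1, \<dots>, m\<close>.
\<close>

fun asc :: "nat \<Rightarrow> nat \<Rightarrow> 'a"
  where
    "asc k 0 = \<one>"
  | "asc k (Suc m) = (if k \<le> m then asc k m \<otimes> r m else \<one>)"

lemma asc_closed [simp]: "1 \<le> k \<Longrightarrow> m \<le> n \<Longrightarrow> asc k m \<in> carrier G"
  by (induction m) auto

lemma asc_trivial: "m \<le> k \<Longrightarrow> asc k m = \<one>"
  by (cases m) auto

lemma asc_commute:
  assumes "1 \<le> i" "i < n" "1 \<le> k" "m \<le> n" "i + 2 \<le> k \<or> m + 1 \<le> i"
  shows "r i \<otimes> asc k m = asc k m \<otimes> r i"
  using assms(4,5)
proof (induction m)
  case (Suc m)
  have "r i \<otimes> (asc k m \<otimes> r m) = (asc k m \<otimes> r m) \<otimes> r i" if "k \<le> m"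
  proof -
    have IH: "r i \<otimes> asc k m = asc k m \<otimes> r i" using Suc by auto
    have "r i \<otimes> (asc k m \<otimes> r m) = (r i \<otimes> asc k m) \<otimes> r m"
      using Suc.prems that assms by (simp add: m_assoc)
    also have "\<dots> = (asc k m \<otimes> r i) \<otimes> r m" by (simp only: IH)
    finally have "r i \<otimes> (asc k m \<otimes> r m) = (asc k m \<otimes> r i) \<otimes> r m" .
    also have "\<dots> = asc k m \<otimes> (r i \<otimes> r m)"
      using Suc.prems that assms by (simp add: m_assoc)
    also have "r i \<otimes> r m = r m \<otimes> r i"
      using Suc.prems that assms by (intro r_commute) auto
    finally show ?thesis using Suc.prems that assms by (simp add: m_assoc)
  qed
  then show ?case using assms by auto
qed (use assms in auto)

lemma asc_peel:
  assumes "1 \<le> k" "k < m" "m \<le> n"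
  shows "asc k m = r k \<otimes> asc (k + 1) m"
  using assms(2,3)
proof (induction m)
  case (Suc m)
  show ?case
  proof (cases "k = m")
    case True
    then show ?thesis using assms(1) Suc.prems asc_trivial[of m m] by simp
  next
    case False
    then show ?thesis using assms(1) Suc by (simp add: m_assoc)
  qed
qed simp

text \<open>
  Here the braid relation enters: \<open>r\<^sub>i\<close> passes to the factor \<open>r\<^sub>i\<^sub>-\<^sub>1 r\<^sub>i\<close>, becomes \<open>r\<^sub>i\<^sub>-\<^sub>1\<close> there, and commutes
  with the remaining factors on either side.
\<close>

lemma asc_shift:
  assumes "1 \<le> k" "k < i" "i < m" "m \<le> n"
  shows "r i \<otimes> asc k m = asc k m \<otimes> r (i - 1)"
  using assms(3,4)
proof (induction m)
  case (Suc m)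
  show ?case
  proof (cases "i = m")
    case True
    then obtain l where m: "m = Suc l" using assms by (cases m) auto
    have l: "k \<le> l" "1 \<le> l" "Suc l < n" using True m assms Suc.prems by auto
    have e: "asc k (Suc m) = asc k l \<otimes> (r l \<otimes> r (Suc l))"
      using l assms by (simp add: m m_assoc)
    have "r i \<otimes> asc k (Suc m) = (r (Suc l) \<otimes> asc k l) \<otimes> (r l \<otimes> r (Suc l))"
      using l True assms by (simp add: e m m_assoc)
    also have "\<dots> = asc k l \<otimes> (r (Suc l) \<otimes> r l \<otimes> r (Suc l))"
      using l assms by (simp add: asc_commute m_assoc)
    also have "\<dots> = asc k l \<otimes> (r l \<otimes> r (Suc l) \<otimes> r l)"
      using l r_braid[of l] by simp
    also have "\<dots> = asc k (Suc m) \<otimes> r (i - 1)"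
      unfolding e using l True assms by (simp add: m m_assoc)
    finally show ?thesis .
  next
    case False
    then have im: "i < m" using Suc.prems by simp
    have "r i \<otimes> asc k (Suc m) = (r i \<otimes> asc k m) \<otimes> r m"
      using im Suc.prems assms by (simp add: m_assoc)
    also have "\<dots> = asc k m \<otimes> (r (i - 1) \<otimes> r m)"
      using im Suc assms by (simp add: m_assoc)
    also have "r (i - 1) \<otimes> r m = r m \<otimes> r (i - 1)"
      using im Suc.prems assms by (intro r_commute) auto
    finally show ?thesis using im Suc.prems assms by (simp add: m_assoc)
  qed
qed simp

text \<open>
  The set of these products contains \<open>1\<close> and is closed under left multiplication by each \<open>r\<^sub>i\<close>: depending
  on the position of \<open>i\<close> relative to \<open>k\<close>, either \<open>k\<close> changes by one or the generator passes through
  \<open>asc\<close> and is absorbed by the second factor.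
\<close>

lemma generate_normal_form:
  assumes m: "Suc m \<le> n" and x: "x \<in> generate G (r ` {1..<Suc m})"
  shows "\<exists>k a. 1 \<le> k \<and> k \<le> Suc m \<and> a \<in> generate G (r ` {1..<m}) \<and> x = asc k (Suc m) \<otimes> a"
  using r_closed_image[OF m] x
proof (induction rule: generate_left_induct)
  case one
  show ?case by (rule exI[of _ "Suc m"], rule exI[of _ \<one>]) (use generate.one in auto)
next
  case (step x g)
  let ?M = "generate G (r ` {1..<m})"
  obtain k a where k: "1 \<le> k" "k \<le> Suc m" and a: "a \<in> ?M" and x: "x = asc k (Suc m) \<otimes> a"
    using step by blast
  obtain i where i: "1 \<le> i" "i \<le> m" "g = r i" using step by auto
  have M: "?M \<subseteq> carrier G" using m by (intro generate_incl r_closed_image) auto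
  then have ac: "a \<in> carrier G" using a by auto
  have gen: "r j \<otimes> a \<in> ?M" if "1 \<le> j" "j < m" for j
    using that by (intro generate.eng[OF generate.incl a]) auto
  have *: "r i \<otimes> x = r i \<otimes> asc k (Suc m) \<otimes> a"
    using i k m ac x by (simp add: m_assoc)
  consider "i + 2 \<le> k" | "i + 1 = k" | "i = k" | "k < i" by linarith
  then have "\<exists>k a. 1 \<le> k \<and> k \<le> Suc m \<and> a \<in> ?M \<and> r i \<otimes> x = asc k (Suc m) \<otimes> a"
  proof cases
    case 1
    then have "r i \<otimes> x = asc k (Suc m) \<otimes> (r i \<otimes> a)"
      unfolding * using i k m ac asc_commute[of i k "Suc m"] asc_closed[of k "Suc m"]
      by (simp add: m_assoc del: asc.simps)
    then show ?thesis using k gen[of i] i 1 by (intro exI[of _ k] exI[of _ "r i \<otimes> a"]) auto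
  next
    case 2
    then have "r i \<otimes> x = asc i (Suc m) \<otimes> a"
      unfolding * using i m asc_peel[of i "Suc m"] by (simp del: asc.simps)
    then show ?thesis using k i a by (intro exI[of _ i] exI[of _ a]) auto
  next
    case 3
    then have "r i \<otimes> x = asc (i + 1) (Suc m) \<otimes> a"
      unfolding * using i m asc_peel[of i "Suc m"] asc_closed[of "i + 1" "Suc m"]
      by (simp del: asc.simps)
    then show ?thesis using k i a by (intro exI[of _ "i + 1"] exI[of _ a]) auto
  next
    case 4
    then have "r i \<otimes> x = asc k (Suc m) \<otimes> (r (i - 1) \<otimes> a)"
      unfolding * using i k m ac asc_shift[of k i "Suc m"] asc_closed[of k "Suc m"]
      by (simp add: m_assoc del: asc.simps)
    then show ?thesis using k gen[of "i - 1"] i 4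
      by (intro exI[of _ k] exI[of _ "r (i - 1) \<otimes> a"]) auto
  qed
  then show ?case using i m by simp
qed

context
  fixes h :: "'a \<Rightarrow> nat \<Rightarrow> nat"
  assumes h: "h \<in> hom G (sym_group n)"
    and h_r: "\<And>i. 1 \<le> i \<Longrightarrow> i < n \<Longrightarrow> h (r i) = transpose i (i + 1)"
begin

lemma h_mult: "x \<in> carrier G \<Longrightarrow> y \<in> carrier G \<Longrightarrow> h (x \<otimes> y) = h x \<circ> h y"
  using h by (auto simp: hom_def sym_group_mult)

lemma h_one: "h \<one> = id"
  using hom_one[OF h is_group sym_group_is_group] by (simp add: sym_group_one)

lemma h_generate_fixes:
  assumes "m \<le> n" "x \<in> generate G (r ` {1..<m})" "m < j"
  shows "h x j = j"
  using r_closed_image[OF assms(1)] assms(2)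
proof (induction rule: generate_left_induct)
  case (step a g)
  then obtain i where i: "1 \<le> i" "i < m" "g = r i" by auto
  moreover have "a \<in> carrier G" using step generate_incl[OF r_closed_image[OF assms(1)]] by auto
  ultimately have "h (g \<otimes> a) j = j"
    using assms step by (simp add: h_mult h_r)
  then show ?case using i assms by simp
qed (simp add: h_one)

lemma h_asc: "1 \<le> k \<Longrightarrow> k \<le> Suc m \<Longrightarrow> Suc m \<le> n \<Longrightarrow> h (asc k (Suc m)) (Suc m) = k"
proof (induction m)
  case 0
  then have "k = 1" by simp
  then show ?case by (simp add: h_one)
next
  case (Suc m)
  show ?case
  proof (cases "k \<le> Suc m")
    case True
    then have "h (asc k (Suc m)) (Suc m) = k" using Suc by auto
    moreover have "asc k (Suc (Suc m)) = asc k (Suc m) \<otimes> r (Suc m)" using True by simp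
    moreover have "asc k (Suc m) \<in> carrier G" using Suc.prems by (intro asc_closed) auto
    ultimately show ?thesis
      using Suc.prems by (simp add: h_mult h_r del: asc.simps)
  next
    case False
    then show ?thesis using Suc.prems by (simp add: h_one)
  qed
qed

text \<open>
  In the normal form \<open>asc k (m + 1) a\<close> the factor \<open>a\<close> fixes \<open>m + 1\<close>. So the image of \<open>m + 1\<close> is \<open>k\<close>, and a
  trivial permutation forces \<open>k = m + 1\<close>, that is, the first factor is \<open>1\<close>. Induction on \<open>m\<close> does the rest.
\<close>

lemma coxeter_faithful:
  assumes "m \<le> n" "x \<in> generate G (r ` {1..<m})" "h x = id"
  shows "x = \<one>"
  using assms
proof (induction m arbitrary: x)
  case 0
  then show ?case using generate_empty by simp
next
  case (Suc m)
  obtain k a where k: "1 \<le> k" "k \<le> Suc m" and a: "a \<in> generate G (r ` {1..<m})"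
    and x: "x = asc k (Suc m) \<otimes> a"
    using generate_normal_form[OF Suc.prems(1,2)] by blast
  have ac: "a \<in> carrier G" using a generate_incl[OF r_closed_image[of m]] Suc.prems by auto
  have "h x (Suc m) = k"
    unfolding x using ac k Suc.prems h_generate_fixes[OF _ a, of "Suc m"] h_asc[OF k]
      asc_closed[of k "Suc m"]
    by (simp add: h_mult del: asc.simps)
  then have "k = Suc m" using Suc.prems by simp
  then have "x = a" using x ac by simp
  then show ?case using Suc a by auto
qed

end

end

section \<open>Conjugation and commutation of the \<open>\<lambda>\<^sub>i\<^sub>j\<close>\<close>

text \<open>
  The defining relations of the virtual twin group, imposed on elements of an arbitrary group. The
  group \<open>VT\<^sub>n\<close> is one instance; the symmetric group and its semidirect product with a right-angled
  Artin group are others.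
\<close>

locale vt_system = coxeter_system +
  fixes s :: "nat \<Rightarrow> 'a"
  assumes s_closed [simp]: "1 \<le> i \<Longrightarrow> i < n \<Longrightarrow> s i \<in> carrier G"
    and s_square [simp]: "1 \<le> i \<Longrightarrow> i < n \<Longrightarrow> s i \<otimes> s i = \<one>"
    and s_commute: "1 \<le> i \<Longrightarrow> i < n \<Longrightarrow> 1 \<le> j \<Longrightarrow> j < n \<Longrightarrow> i + 2 \<le> j \<or> j + 2 \<le> i \<Longrightarrow>
      s i \<otimes> s j = s j \<otimes> s i"
    and rs_commute: "1 \<le> i \<Longrightarrow> i < n \<Longrightarrow> 1 \<le> j \<Longrightarrow> j < n \<Longrightarrow> i + 2 \<le> j \<or> j + 2 \<le> i \<Longrightarrow>
      r i \<otimes> s j = s j \<otimes> r i"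
    and mixed: "1 \<le> i \<Longrightarrow> i + 1 < n \<Longrightarrow> r i \<otimes> r (i + 1) \<otimes> s i = s (i + 1) \<otimes> r i \<otimes> r (i + 1)"
begin

fun lamb :: "nat \<Rightarrow> nat \<Rightarrow> 'a"
  where
    "lamb i 0 = \<one>"
  | "lamb i (Suc j) = (if j \<le> i then s i \<otimes> r i else r j \<otimes> lamb i j \<otimes> r j)"

lemma lamb_closed [simp]: "1 \<le> i \<Longrightarrow> i < j \<Longrightarrow> j \<le> n \<Longrightarrow> lamb i j \<in> carrier G"
  by (induction j) auto

lemma s_cancel [simp]: "1 \<le> i \<Longrightarrow> i < n \<Longrightarrow> x \<in> carrier G \<Longrightarrow> s i \<otimes> (s i \<otimes> x) = x"
  by (simp flip: m_assoc)

lemma lamb_adjacent: "lamb i (Suc i) = s i \<otimes> r i"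
  by simp

lemma lamb_extend: "i < j \<Longrightarrow> lamb i (Suc j) = r j \<otimes> lamb i j \<otimes> r j"
  by simp

declare lamb.simps [simp del]

lemma conj_twice:
  "1 \<le> k \<Longrightarrow> k < n \<Longrightarrow> x \<in> carrier G \<Longrightarrow> r k \<otimes> (r k \<otimes> x \<otimes> r k) \<otimes> r k = x"
  by (simp add: m_assoc)

lemma conj_if_commute:
  "1 \<le> k \<Longrightarrow> k < n \<Longrightarrow> x \<in> carrier G \<Longrightarrow> r k \<otimes> x = x \<otimes> r k \<Longrightarrow> r k \<otimes> x \<otimes> r k = x"
  by (simp add: m_assoc)

lemma lamb_far:
  assumes k: "1 \<le> k" "k < n" and i: "1 \<le> i" "i < j" "j \<le> n" "k + 1 < i \<or> j < k"
  shows "r k \<otimes> lamb i j = lamb i j \<otimes> r k"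
  using i(2-4)
proof (induction j)
  case (Suc j)
  show ?case
  proof (cases "i = j")
    case True
    then show ?thesis unfolding True lamb_adjacent
      using Suc.prems k i by (intro commute_mult rs_commute r_commute) auto
  next
    case False
    then show ?thesis 
      using Suc k i by (simp add: lamb_extend, intro commute_mult r_commute m_closed) auto
  qed
qed simp

text \<open>
  When \<open>j = k + 2\<close>, the conjugation by \<open>r\<^sub>k\<close> meets \<open>r\<^sub>k\<^sub>+\<^sub>1 r\<^sub>k\<close>, and the braid relation turns it into a
  conjugation by \<open>r\<^sub>k\<^sub>+\<^sub>1\<close>, which commutes with \<open>\<lambda>\<^sub>i\<^sub>k\<close>. For larger \<open>j\<close> it commutes with the outermost factor.
\<close>

lemma lamb_inner:
  assumes i: "1 \<le> i" "i < k" "k + 1 < j" "j \<le> n"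
  shows "r k \<otimes> lamb i j \<otimes> r k = lamb i j"
  using i(3,4)
proof (induction j)
  case (Suc j)
  show ?case
  proof (cases "j = k + 1")
    case True
    have "r (k + 1) \<otimes> lamb i k = lamb i k \<otimes> r (k + 1)"
      using True Suc.prems i by (intro lamb_far) auto
    then show ?thesis
      using True Suc.prems i conj_comm_braid[of "r k" "r (Suc k)" "lamb i k"] r_braid[of k]
      by (simp add: lamb_extend)
  next
    case False
    have "r k \<otimes> lamb i (Suc j) \<otimes> r k = r j \<otimes> (r k \<otimes> lamb i j \<otimes> r k) \<otimes> r j"
      using False Suc.prems i
      by (subst lamb_extend) (auto intro!: conj_swap r_commute)
    also have "\<dots> = lamb i (Suc j)" using False Suc i by (simp add: lamb_extend)
    finally show ?thesis .
  qed
qed simp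

text \<open>
  The base case \<open>j = i + 2\<close> is the mixed relation \<open>r\<^sub>i r\<^sub>i\<^sub>+\<^sub>1 s\<^sub>i = s\<^sub>i\<^sub>+\<^sub>1 r\<^sub>i r\<^sub>i\<^sub>+\<^sub>1\<close>.
\<close>

lemma lamb_lower:
  assumes i: "1 \<le> i" "i + 1 < j" "j \<le> n"
  shows "r i \<otimes> lamb i j \<otimes> r i = lamb (i + 1) j"
  using i(2,3)
proof (induction j)
  case (Suc j)
  show ?case
  proof (cases "j = i + 1")
    case True
    let ?a = "r i" and ?b = "r (i + 1)"
    have c: "?a \<in> carrier G" "?b \<in> carrier G" "s i \<in> carrier G" "s (i + 1) \<in> carrier G"
      using True Suc.prems i by auto
    have "?a \<otimes> lamb i (Suc j) \<otimes> ?a = (?a \<otimes> ?b \<otimes> s i) \<otimes> (?a \<otimes> ?b \<otimes> ?a)"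
      using c by (simp add: True lamb_extend lamb_adjacent m_assoc)
    also have "\<dots> = (s (i + 1) \<otimes> ?a \<otimes> ?b) \<otimes> (?b \<otimes> ?a \<otimes> ?b)"
      using mixed[of i] r_braid[of i] True Suc.prems i by simp
    also have "\<dots> = s (i + 1) \<otimes> ?b"
      using c True Suc.prems i by (simp add: m_assoc)
    finally show ?thesis using True by (simp add: lamb_adjacent)
  next
    case False
    have "r i \<otimes> lamb i (Suc j) \<otimes> r i = r j \<otimes> (r i \<otimes> lamb i j \<otimes> r i) \<otimes> r j"
      using False Suc.prems i
      by (subst lamb_extend) (auto intro!: conj_swap r_commute)
    also have "\<dots> = lamb (i + 1) (Suc j)" using False Suc i by (simp add: lamb_extend)
    finally show ?thesis .
  qed
qed simp

text \<open>
  Reading \<open>\<lambda>\<^sub>b\<^sub>a\<close> as the inverse of \<open>\<lambda>\<^sub>a\<^sub>b\<close> makes the family closed under conjugation by the \<open>r\<^sub>k\<close>, with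
  the symmetric group acting on the indices.
\<close>

definition Lam :: "nat \<Rightarrow> nat \<Rightarrow> 'a"
  where "Lam a b = (if a < b then lamb a b else inv (lamb b a))"

lemma Lam_closed [simp]: "a \<noteq> b \<Longrightarrow> a \<in> {1..n} \<Longrightarrow> b \<in> {1..n} \<Longrightarrow> Lam a b \<in> carrier G"
  by (auto simp: Lam_def)

text \<open>
  The sign in \<open>Lam\<close> comes from one case only, \<open>\<lambda>\<^sub>k\<^sub>,\<^sub>k\<^sub>+\<^sub>1 = s\<^sub>k r\<^sub>k\<close>, which \<open>r\<^sub>k\<close> conjugates to \<open>r\<^sub>k s\<^sub>k\<close>.
\<close>

lemma conj_lamb:
  assumes k: "1 \<le> k" "k < n" and i: "1 \<le> i" "i < j" "j \<le> n"
  shows "r k \<otimes> lamb i j \<otimes> r k = Lam (transpose k (k + 1) i) (transpose k (k + 1) j)"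
proof -
  consider "k + 1 < i \<or> j < k" | "k = j" | "k + 1 = j" "i < k" | "k + 1 = j" "i = k"
    | "i < k" "k + 1 < j" | "k = i" "k + 1 < j" | "k + 1 = i"
    using i by linarith
  then show ?thesis
  proof cases
    case 1
    then have "r k \<otimes> lamb i j \<otimes> r k = lamb i j"
      using k i by (intro conj_if_commute lamb_far) auto
    then show ?thesis using 1 i by (auto simp: Lam_def transpose_def)
  next
    case 2
    then show ?thesis using i by (auto simp: Lam_def transpose_def lamb_extend)
  next
    case 3
    then have "lamb i j = r k \<otimes> lamb i k \<otimes> r k" by (metis Suc_eq_plus1 lamb_extend)
    then have "r k \<otimes> lamb i j \<otimes> r k = lamb i k" using 3 k i by (simp add: conj_twice)
    then show ?thesis using 3 i by (auto simp: Lam_def transpose_def)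
  next
    case 4
    then have j: "j = Suc i" by simp
    have "inv (lamb i j) = r i \<otimes> s i"
      unfolding j lamb_adjacent using 4 k by (intro inv_equality) (auto simp: m_assoc)
    moreover have "r k \<otimes> lamb i j \<otimes> r k = r i \<otimes> s i"
      unfolding j lamb_adjacent using 4 k by (auto simp: m_assoc)
    ultimately show ?thesis using 4 by (simp add: Lam_def transpose_def)
  next
    case 5
    then show ?thesis using i lamb_inner[of i k j] by (auto simp: Lam_def transpose_def)
  next
    case 6
    then show ?thesis using i lamb_lower[of i j] by (auto simp: Lam_def transpose_def)
  next
    case 7
    then have "r k \<otimes> lamb k j \<otimes> r k = lamb i j" using lamb_lower[of k j] k i by auto
    then have "r k \<otimes> lamb i j \<otimes> r k = lamb k j" using conj_twice[of k "lamb k j"] 7 k i by auto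
    then show ?thesis using 7 i by (auto simp: Lam_def transpose_def)
  qed
qed

lemma inv_Lam: "a \<noteq> b \<Longrightarrow> a \<in> {1..n} \<Longrightarrow> b \<in> {1..n} \<Longrightarrow> inv (Lam a b) = Lam b a"
  by (auto simp: Lam_def)

lemma transpose_in: "1 \<le> k \<Longrightarrow> k < n \<Longrightarrow> a \<in> {1..n} \<Longrightarrow> transpose k (k + 1) a \<in> {1..n}"
  by (auto simp: transpose_def)

lemma conj_Lam:
  assumes k: "1 \<le> k" "k < n" and ab: "a \<noteq> b" "a \<in> {1..n}" "b \<in> {1..n}"
  shows "r k \<otimes> Lam a b \<otimes> r k = Lam (transpose k (k + 1) a) (transpose k (k + 1) b)"
proof (cases "a < b")
  case True
  then show ?thesis using conj_lamb[OF k] ab by (simp add: Lam_def)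
next
  case False
  then have ba: "b < a" using ab by simp
  have "r k \<otimes> Lam a b \<otimes> r k = inv (r k \<otimes> lamb b a \<otimes> r k)"
    using ba ab k by (simp add: Lam_def inv_mult_group m_assoc)
  also have "r k \<otimes> lamb b a \<otimes> r k = Lam (transpose k (k + 1) b) (transpose k (k + 1) a)"
    using ba ab k by (intro conj_lamb) auto
  also have "inv \<dots> = Lam (transpose k (k + 1) a) (transpose k (k + 1) b)"
    using ab k by (intro inv_Lam transpose_in) (auto simp: transpose_eq_iff)
  finally show ?thesis .
qed

lemma commute_conj:
  assumes k: "1 \<le> k" "k < n" and x: "x \<in> carrier G" and y: "y \<in> carrier G"
    and c: "(r k \<otimes> x \<otimes> r k) \<otimes> (r k \<otimes> y \<otimes> r k) = (r k \<otimes> y \<otimes> r k) \<otimes> (r k \<otimes> x \<otimes> r k)"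
  shows "x \<otimes> y = y \<otimes> x"
proof -
  have *: "(r k \<otimes> u \<otimes> r k) \<otimes> (r k \<otimes> v \<otimes> r k) = r k \<otimes> (u \<otimes> v) \<otimes> r k"
    if "u \<in> carrier G" "v \<in> carrier G" for u v
    using that k by (simp add: m_assoc)
  have "r k \<otimes> (x \<otimes> y) \<otimes> r k = r k \<otimes> (y \<otimes> x) \<otimes> r k"
    using c unfolding *[OF x y] *[OF y x] .
  from arg_cong[OF this, of "\<lambda>u. r k \<otimes> u \<otimes> r k"] show ?thesis
    unfolding conj_twice[OF k m_closed[OF x y]] conj_twice[OF k m_closed[OF y x]] .
qed

lemma Lam_commute_base:
  assumes n: "4 \<le> n"
  shows "lamb 1 2 \<otimes> lamb 3 4 = lamb 3 4 \<otimes> lamb 1 2"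
    and "lamb 1 3 \<otimes> lamb 2 4 = lamb 2 4 \<otimes> lamb 1 3"
    and "lamb 1 4 \<otimes> lamb 2 3 = lamb 2 3 \<otimes> lamb 1 4"
proof -
  have e: "lamb 1 2 = s 1 \<otimes> r 1" "lamb 3 4 = s 3 \<otimes> r 3"
    using lamb_adjacent[of 1] lamb_adjacent[of 3] by (simp_all add: numeral_eq_Suc)
  have p: "(s 1 \<otimes> r 1) \<otimes> s 3 = s 3 \<otimes> (s 1 \<otimes> r 1)"
    using n by (intro commute_mult[symmetric] s_commute rs_commute[symmetric]) auto
  have q: "(s 1 \<otimes> r 1) \<otimes> r 3 = r 3 \<otimes> (s 1 \<otimes> r 1)"
    using n by (intro commute_mult[symmetric] r_commute rs_commute) auto
  show 1: "lamb 1 2 \<otimes> lamb 3 4 = lamb 3 4 \<otimes> lamb 1 2"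
    unfolding e using n p q by (intro commute_mult) auto
  have "r 2 \<otimes> lamb 1 3 \<otimes> r 2 = lamb 1 2" "r 2 \<otimes> lamb 2 4 \<otimes> r 2 = lamb 3 4"
    using conj_lamb[of 2 1 3] conj_lamb[of 2 2 4] n by (auto simp: Lam_def transpose_def)
  then show 2: "lamb 1 3 \<otimes> lamb 2 4 = lamb 2 4 \<otimes> lamb 1 3"
    using 1 n by (intro commute_conj[of 2 "lamb 1 3" "lamb 2 4"]) auto
  have "r 3 \<otimes> lamb 1 4 \<otimes> r 3 = lamb 1 3" "r 3 \<otimes> lamb 2 3 \<otimes> r 3 = lamb 2 4"
    using conj_lamb[of 3 1 4] conj_lamb[of 3 2 3] n by (auto simp: Lam_def transpose_def)
  then show "lamb 1 4 \<otimes> lamb 2 3 = lamb 2 3 \<otimes> lamb 1 4"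
    using 2 n by (intro commute_conj[of 3 "lamb 1 4" "lamb 2 3"]) auto
qed

text \<open>
  Conjugation by \<open>r\<^sub>k\<close> lowers an index \<open>k + 1\<close> to \<open>k\<close> if \<open>k\<close> is not used, so one may descend until the four
  indices are \<open>1, 2, 3, 4\<close>. There the three pairings follow from the commutation of \<open>s\<^sub>1, r\<^sub>1\<close> with
  \<open>s\<^sub>3, r\<^sub>3\<close>.
\<close>

lemma Lam_commute:
  assumes "a \<in> {1..n}" "b \<in> {1..n}" "c \<in> {1..n}" "d \<in> {1..n}" "distinct [a, b, c, d]"
  shows "Lam a b \<otimes> Lam c d = Lam c d \<otimes> Lam a b"
  using assms
proof (induction "a + b + c + d" arbitrary: a b c d rule: less_induct)
  case less
  let ?S = "{a, b, c, d}"
  show ?case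
  proof (cases "\<exists>x\<in>?S. 1 < x \<and> x - 1 \<notin> ?S")
    case True
    then obtain k where k: "k + 1 \<in> ?S" "1 \<le> k" "k \<notin> ?S"
    proof -
      from True obtain x where x: "x \<in> ?S" "1 < x" "x - 1 \<notin> ?S" by blast
      then show ?thesis by (intro that[of "x - 1"]) auto
    qed
    then have kn: "k < n" using less.prems by auto
    let ?t = "transpose k (k + 1)"
    have "?t a + ?t b + ?t c + ?t d < a + b + c + d"
      using k by (auto simp: transpose_def)
    moreover have "?t a \<in> {1..n}" "?t b \<in> {1..n}" "?t c \<in> {1..n}" "?t d \<in> {1..n}"
      by (rule transpose_in[OF k(2) kn], fact)+
    moreover have "distinct [?t a, ?t b, ?t c, ?t d]"
      using less.prems(5) by (auto simp: transpose_eq_iff)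
    ultimately have "Lam (?t a) (?t b) \<otimes> Lam (?t c) (?t d) = Lam (?t c) (?t d) \<otimes> Lam (?t a) (?t b)"
      by (rule less.hyps)
    then show ?thesis
      using k kn less.prems by (intro commute_conj[of k "Lam a b" "Lam c d"]) (auto simp: conj_Lam)
  next
    case False
    then have step: "x - 1 \<in> ?S" if "x \<in> ?S" "1 < x" for x using that by blast
    have down: "y \<in> ?S" if "y \<le> x" "1 \<le> y" "x \<in> ?S" for x y
      using that
    proof (induction rule: inc_induct)
      case (step m)
      then show ?case using \<open>\<And>x. x \<in> ?S \<Longrightarrow> 1 < x \<Longrightarrow> x - 1 \<in> ?S\<close>[of "Suc m"] by simp
    qed
    have card: "card ?S = 4" using less.prems(5) by simp
    have small: "x \<le> 4" if "x \<in> ?S" for x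
    proof -
      have "{1..x} \<subseteq> ?S"
        by (rule subsetI, rule down[of _ x]) (use that in simp_all)
      then have "card {1..x} \<le> card ?S" by (intro card_mono) auto
      then show ?thesis using card by simp
    qed
    have "?S \<subseteq> {1..4}" using small[of a] small[of b] small[of c] small[of d] less.prems by simp
    then have "?S = {1..4}" using card by (intro card_subset_eq) auto
    then have "4 \<in> ?S" by simp
    then have n: "4 \<le> n" using less.prems by auto
    note base = Lam_commute_base[OF n]
    \<comment> \<open>Up to inverses and order, the indices form one of the three pairings of 1, 2, 3, 4.\<close>
    have key: "lamb p q \<otimes> lamb u v = lamb u v \<otimes> lamb p q"
      if "1 \<le> p" "p < q" "q \<le> 4" "1 \<le> u" "u < v" "v \<le> 4" "distinct [p, q, u, v]" for p q u v
    proof -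
      have "p = 1 \<and> q = 2 \<and> u = 3 \<and> v = 4 \<or> p = 1 \<and> q = 3 \<and> u = 2 \<and> v = 4 \<or>
        p = 1 \<and> q = 4 \<and> u = 2 \<and> v = 3 \<or> p = 3 \<and> q = 4 \<and> u = 1 \<and> v = 2 \<or>
        p = 2 \<and> q = 4 \<and> u = 1 \<and> v = 3 \<or> p = 2 \<and> q = 3 \<and> u = 1 \<and> v = 4"
        using that by simp presburger
      then show ?thesis using base by (elim disjE) simp_all
    qed
    have Lam_lamb: "Lam x y = lamb (min x y) (max x y) \<or> Lam x y = inv (lamb (min x y) (max x y))"
      for x y by (auto simp: Lam_def)
    have c: "lamb (min a b) (max a b) \<in> carrier G" "lamb (min c d) (max c d) \<in> carrier G"
      using less.prems by auto
    have e: "lamb (min a b) (max a b) \<otimes> lamb (min c d) (max c d) =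
        lamb (min c d) (max c d) \<otimes> lamb (min a b) (max a b)"
      using less.prems small by (intro key) (auto simp: min_def max_def)
    note e1 = commute_inv[OF c e] and e2 = commute_inv[OF c(2,1) e[symmetric], symmetric]
    have e3: "inv (lamb (min a b) (max a b)) \<otimes> inv (lamb (min c d) (max c d)) =
        inv (lamb (min c d) (max c d)) \<otimes> inv (lamb (min a b) (max a b))"
      by (rule commute_inv[OF c(1) inv_closed[OF c(2)] e2])
    show ?thesis
      using Lam_lamb[of a b] Lam_lamb[of c d] e e1 e2 e3 by (elim disjE) simp_all
  qed
qed

lemma lamb_image_closed: "(\<lambda>(i, j). lamb i j) ` strand_pairs n \<subseteq> carrier G"
  by (auto simp: strand_pairs_def)

lemma conj_generate_lamb:
  assumes k: "1 \<le> k" "k < n" and x: "x \<in> generate G ((\<lambda>(i, j). lamb i j) ` strand_pairs n)"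
  shows "r k \<otimes> x \<otimes> r k \<in> generate G ((\<lambda>(i, j). lamb i j) ` strand_pairs n)"
proof -
  let ?L = "(\<lambda>(i, j). lamb i j) ` strand_pairs n"
  have LamK: "Lam a b \<in> generate G ?L" if "a \<in> {1..n}" "b \<in> {1..n}" "a \<noteq> b" for a b
    using that by (force simp: Lam_def strand_pairs_def intro: generate.incl generate.inv)
  have conjK: "r k \<otimes> Lam a b \<otimes> r k \<in> generate G ?L" if "a \<in> {1..n}" "b \<in> {1..n}" "a \<noteq> b" for a b
    unfolding conj_Lam[OF k that(3,1,2)] using that k
    by (intro LamK transpose_in) (auto simp: transpose_eq_iff)
  from x show ?thesis
  proof induction
    case one
    then show ?case using k by (simp add: generate.one)
  next
    case (incl h)
    then obtain i j where "h = Lam i j" "1 \<le> i" "i < j" "j \<le> n"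
      by (auto simp: strand_pairs_def Lam_def)
    then show ?case using conjK[of i j] by simp
  next
    case (inv h)
    then obtain i j where h: "inv h = Lam j i" "1 \<le> i" "i < j" "j \<le> n"
      by (auto simp: strand_pairs_def Lam_def)
    show ?case unfolding h(1) using h conjK[of j i] by simp
  next
    case (eng x y)
    note c = generate_in_carrier[OF lamb_image_closed eng(1)]
      generate_in_carrier[OF lamb_image_closed eng(2)]
    have "r k \<otimes> (x \<otimes> y) \<otimes> r k = (r k \<otimes> x \<otimes> r k) \<otimes> (r k \<otimes> y \<otimes> r k)"
      using c k by (simp add: m_assoc)
    then show ?case using eng by (simp only: generate.eng)
  qed
qed

text \<open>
  The \<open>r\<^sub>i\<close> can be pushed to the right past the \<open>\<lambda>\<^sub>i\<^sub>j\<close>, which conjugation permutes up to inversion, and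
  \<open>s\<^sub>i = \<lambda>\<^sub>i\<^sub>,\<^sub>i\<^sub>+\<^sub>1 r\<^sub>i\<close>.
\<close>

lemma generate_eq_lamb_times_r:
  assumes x: "x \<in> generate G (s ` {1..<n} \<union> r ` {1..<n})"
  shows "\<exists>k w. k \<in> generate G ((\<lambda>(i, j). lamb i j) ` strand_pairs n) \<and>
    w \<in> generate G (r ` {1..<n}) \<and> x = k \<otimes> w"
proof -
  let ?K = "generate G ((\<lambda>(i, j). lamb i j) ` strand_pairs n)"
  let ?W = "generate G (r ` {1..<n})"
  have "s ` {1..<n} \<union> r ` {1..<n} \<subseteq> carrier G" by auto
  then show ?thesis using x
  proof (induction rule: generate_left_induct)
    case one
    show ?case by (rule exI[of _ \<one>], rule exI[of _ \<one>]) (simp add: generate.one)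
  next
    case (step x g)
    obtain k w where k: "k \<in> ?K" and w: "w \<in> ?W" and x: "x = k \<otimes> w"
      using step by blast
    have kc: "k \<in> carrier G" by (rule generate_in_carrier[OF lamb_image_closed k])
    have wc: "w \<in> carrier G" by (rule generate_in_carrier[OF r_closed_image[OF le_refl] w])
    obtain i where i: "1 \<le> i" "i < n" and g: "g = s i \<or> g = r i" using step by auto
    have k': "r i \<otimes> k \<otimes> r i \<in> ?K" using conj_generate_lamb[OF i k] .
    have w': "r i \<otimes> w \<in> ?W" using i by (intro generate.eng[OF generate.incl w]) auto
    have rx: "r i \<otimes> x = (r i \<otimes> k \<otimes> r i) \<otimes> (r i \<otimes> w)"
      using i kc wc by (simp add: x m_assoc)
    have sx: "s i \<otimes> x = (lamb i (Suc i) \<otimes> (r i \<otimes> k \<otimes> r i)) \<otimes> (r i \<otimes> w)"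
      using i kc wc by (simp add: x lamb_adjacent m_assoc)
    have "lamb i (Suc i) \<in> ?K" using i by (intro generate.incl) (force simp: strand_pairs_def)
    then have sk: "lamb i (Suc i) \<otimes> (r i \<otimes> k \<otimes> r i) \<in> ?K" using k' by (rule generate.eng)
    have inv: "inv (s i) = s i" using i by (intro inv_equality) auto
    have inv_g: "inv g = g" using g inv i by auto
    show ?case unfolding inv_g using g rx sx k' w' sk by blast
  qed
qed

end

section \<open>The virtual twin group\<close>

lemma VT_presentation: "presentation (VT_gens n) (VT_rels n)"
  by unfold_locales (auto simp: VT_gens_def VT_rels_def)

interpretation VT: group "VT n"
  unfolding VT_def by (rule group_presented_group)

lemma VT_system: "vt_system (VT n) n (\<lambda>i. VT_class n [rg i]) (\<lambda>i. VT_class n [sg i])"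
proof -
  interpret P: presentation "VT_gens n" "VT_rels n" by (rule VT_presentation)
  have cl [simp]: "VT_class n [rg i] \<in> carrier (VT n)" "VT_class n [sg i] \<in> carrier (VT n)"
    if "1 \<le> i" "i < n" for i
    using that P.letter_closed by (auto simp: VT_def VT_class_def VT_gens_def)
  have rel: "word_val (VT n) (\<lambda>x. VT_class n [(x, True)]) u = word_val (VT n) (\<lambda>x. VT_class n [(x, True)]) v"
    if "(u, v) \<in> VT_rels n" for u v
    using P.letter_rel[OF that] by (simp add: VT_def VT_class_def)
  show ?thesis
  proof unfold_locales
    show "VT_class n [rg i] \<otimes>\<^bsub>VT n\<^esub> VT_class n [rg i] = \<one>\<^bsub>VT n\<^esub>"
      "VT_class n [sg i] \<otimes>\<^bsub>VT n\<^esub> VT_class n [sg i] = \<one>\<^bsub>VT n\<^esub>" if i: "1 \<le> i" "i < n" for i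
      using rel[of "[rg i, rg i]" "[]"] rel[of "[sg i, sg i]" "[]"] i
      by (auto simp: VT_rels_def)
    fix i j assume i: "1 \<le> i" "i < n" "1 \<le> j" "j < n" and ij: "i + 2 \<le> j \<or> j + 2 \<le> i"
    have d: "\<bar>int i - int j\<bar> \<ge> 2" "i \<le> n - 1" "j \<le> n - 1" using i ij by auto
    show "VT_class n [rg i] \<otimes>\<^bsub>VT n\<^esub> VT_class n [rg j] = VT_class n [rg j] \<otimes>\<^bsub>VT n\<^esub> VT_class n [rg i]"
      using rel[of "[rg i, rg j]" "[rg j, rg i]"] i d by (auto simp: VT_rels_def)
    show "VT_class n [sg i] \<otimes>\<^bsub>VT n\<^esub> VT_class n [sg j] = VT_class n [sg j] \<otimes>\<^bsub>VT n\<^esub> VT_class n [sg i]"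
      using rel[of "[sg i, sg j]" "[sg j, sg i]"] i d by (auto simp: VT_rels_def)
    show "VT_class n [rg i] \<otimes>\<^bsub>VT n\<^esub> VT_class n [sg j] = VT_class n [sg j] \<otimes>\<^bsub>VT n\<^esub> VT_class n [rg i]"
      using rel[of "[rg i, sg j]" "[sg j, rg i]"] i d by (auto simp: VT_rels_def)
  next
    fix i assume i: "1 \<le> i" "i + 1 < n"
    then have d: "i \<in> {1..n - 2}" by auto
    show "VT_class n [rg i] \<otimes>\<^bsub>VT n\<^esub> VT_class n [rg (i + 1)] \<otimes>\<^bsub>VT n\<^esub> VT_class n [rg i] =
      VT_class n [rg (i + 1)] \<otimes>\<^bsub>VT n\<^esub> VT_class n [rg i] \<otimes>\<^bsub>VT n\<^esub> VT_class n [rg (i + 1)]"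
      using rel[of "[rg i, rg (i + 1), rg i]" "[rg (i + 1), rg i, rg (i + 1)]"] i d
      by (auto simp: VT_rels_def VT.m_assoc)
    show "VT_class n [rg i] \<otimes>\<^bsub>VT n\<^esub> VT_class n [rg (i + 1)] \<otimes>\<^bsub>VT n\<^esub> VT_class n [sg i] =
      VT_class n [sg (i + 1)] \<otimes>\<^bsub>VT n\<^esub> VT_class n [rg i] \<otimes>\<^bsub>VT n\<^esub> VT_class n [rg (i + 1)]"
      using rel[of "[rg i, rg (i + 1), sg i]" "[sg (i + 1), rg i, rg (i + 1)]"] i d
      by (auto simp: VT_rels_def VT.m_assoc)
  qed auto
qed

interpretation VT: vt_system "VT n" n "\<lambda>i. VT_class n [rg i]" "\<lambda>i. VT_class n [sg i]"
  by (rule VT_system)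

lemma VT_gens_image:
  "(\<lambda>x. VT_class n [(x, True)]) ` VT_gens n =
    (\<lambda>i. VT_class n [sg i]) ` {1..<n} \<union> (\<lambda>i. VT_class n [rg i]) ` {1..<n}"
  by (cases n) (auto simp: VT_gens_def image_Un image_image atLeastLessThanSuc_atLeastAtMost)

lemma VT_generated:
  "carrier (VT n) = generate (VT n)
    ((\<lambda>i. VT_class n [sg i]) ` {1..<n} \<union> (\<lambda>i. VT_class n [rg i]) ` {1..<n})"
proof -
  interpret P: presentation "VT_gens n" "VT_rels n" by (rule VT_presentation)
  show ?thesis
    unfolding VT_gens_image[symmetric] unfolding VT_def VT_class_def by (rule P.presented_generated)
qed

lemma VT_hom_exists:
  assumes "vt_system G n r s"
  obtains h where "h \<in> hom (VT n) G"
    and "\<And>i. 1 \<le> i \<Longrightarrow> i < n \<Longrightarrow> h (VT_class n [rg i]) = r i"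
    and "\<And>i. 1 \<le> i \<Longrightarrow> i < n \<Longrightarrow> h (VT_class n [sg i]) = s i"
proof -
  interpret P: presentation "VT_gens n" "VT_rels n" by (rule VT_presentation)
  interpret G: vt_system G n r s by fact
  let ?y = "\<lambda>x. case x of Sg i \<Rightarrow> s i | Rg i \<Rightarrow> r i"
  have y: "?y \<in> VT_gens n \<rightarrow> carrier G" by (auto simp: VT_gens_def)
  have rels: "word_val G ?y u = word_val G ?y v" if "(u, v) \<in> VT_rels n" for u v
  proof -
    have far: "i + 2 \<le> j \<or> j + 2 \<le> i" if "\<bar>int i - int j\<bar> \<ge> 2" for i j
      using that by linarith
    have "\<forall>(u, v)\<in>VT_rels n. word_val G ?y u = word_val G ?y v"
      unfolding VT_rels_def ball_Un
    proof (intro conjI, goal_cases)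
      case 1 show ?case by auto
    next
      case 2 show ?case by auto
    next
      case 3 show ?case using G.s_commute[OF _ _ _ _ far] by auto
    next
      case 4 show ?case using G.r_commute[OF _ _ _ _ far] by auto
    next
      case 5 show ?case using G.rs_commute[OF _ _ _ _ far] by auto
    next
      case 6
      have "r i \<otimes>\<^bsub>G\<^esub> (r (Suc i) \<otimes>\<^bsub>G\<^esub> r i) = r (Suc i) \<otimes>\<^bsub>G\<^esub> (r i \<otimes>\<^bsub>G\<^esub> r (Suc i))"
        if "1 \<le> i" "i \<le> n - 2" for i using G.r_braid[of i] that by (simp add: G.m_assoc)
      then show ?case by auto
    next
      case 7
      have "r i \<otimes>\<^bsub>G\<^esub> (r (Suc i) \<otimes>\<^bsub>G\<^esub> s i) = s (Suc i) \<otimes>\<^bsub>G\<^esub> (r i \<otimes>\<^bsub>G\<^esub> r (Suc i))"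
        if "1 \<le> i" "i \<le> n - 2" for i using G.mixed[of i] that by (simp add: G.m_assoc)
      then show ?case by auto
    qed
    then show ?thesis using that by auto
  qed
  obtain h where h: "h \<in> hom (VT n) G" "\<And>x. x \<in> VT_gens n \<Longrightarrow> h (VT_class n [(x, True)]) = ?y x"
    using P.presented_hom_exists[OF G.is_group y rels] by (metis VT_def VT_class_def)
  show thesis
  proof
    show "h (VT_class n [rg i]) = r i" "h (VT_class n [sg i]) = s i" if "1 \<le> i" "i < n" for i
      using h(2)[of "Rg i"] h(2)[of "Sg i"] that by (auto simp: VT_gens_def)
  qed fact
qed

section \<open>Generators of the pure virtual twin group\<close>

lemma sym_system:
  "vt_system (sym_group n) n (\<lambda>i. transpose i (i + 1)) (\<lambda>i. transpose i (i + 1))"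
proof -
  interpret S: group "sym_group n" by (rule sym_group_is_group)
  show ?thesis
    by unfold_locales
      (auto simp: sym_group_def permutes_swap_id fun_eq_iff transpose_def)
qed

lemma VT_perm_props:
  shows VT_perm_hom: "VT_perm n \<in> hom (VT n) (sym_group n)"
    and VT_perm_r: "1 \<le> i \<Longrightarrow> i < n \<Longrightarrow> VT_perm n (VT_class n [rg i]) = transpose i (i + 1)"
    and VT_perm_s: "1 \<le> i \<Longrightarrow> i < n \<Longrightarrow> VT_perm n (VT_class n [sg i]) = transpose i (i + 1)"
proof -
  obtain h where h: "h \<in> hom (VT n) (sym_group n)"
    "\<And>i. 1 \<le> i \<Longrightarrow> i < n \<Longrightarrow> h (VT_class n [rg i]) = transpose i (i + 1)"
    "\<And>i. 1 \<le> i \<Longrightarrow> i < n \<Longrightarrow> h (VT_class n [sg i]) = transpose i (i + 1)"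
    using VT_hom_exists[OF sym_system] by blast
  have e: "VT_perm n = restrict h (carrier (VT n))"
    unfolding VT_perm_def
  proof (rule hom_on_gens_eq_restrict[OF VT.is_group sym_group_is_group])
    show "(\<lambda>x. VT_class n [(x, True)]) ` VT_gens n \<subseteq> carrier (VT n)"
      unfolding VT_gens_image by auto
    show "carrier (VT n) = generate (VT n) ((\<lambda>x. VT_class n [(x, True)]) ` VT_gens n)"
      unfolding VT_gens_image by (rule VT_generated)
    show "h (VT_class n [(x, True)]) = gen_transposition x" if "x \<in> VT_gens n" for x
      using that h(2,3) by (auto simp: VT_gens_def)
  qed (rule h(1))
  show "VT_perm n \<in> hom (VT n) (sym_group n)"
    using VT.restrict_in_hom[OF h(1)] by (simp add: e)
  show "VT_perm n (VT_class n [rg i]) = transpose i (i + 1)"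
    "VT_perm n (VT_class n [sg i]) = transpose i (i + 1)" if "1 \<le> i" "i < n"
    using h(2,3) that by (simp_all add: e)
qed

lemma VT_perm_group_hom: "group_hom (VT n) (sym_group n) (VT_perm n)"
  by (simp add: group_hom_def group_hom_axioms_def VT_perm_hom VT.is_group sym_group_is_group)

lemma PVT_simps [simp]:
  "monoid.mult (PVT n) = monoid.mult (VT n)" "\<one>\<^bsub>PVT n\<^esub> = \<one>\<^bsub>VT n\<^esub>"
  by (simp_all add: PVT_def)

lemma carrier_PVT: "carrier (PVT n) = kernel (VT n) (sym_group n) (VT_perm n)"
  by (simp add: PVT_def)

lemma PVT_eq: "PVT n = VT n\<lparr>carrier := carrier (PVT n)\<rparr>"
  by (simp add: PVT_def)

lemma PVT_subgroup: "subgroup (carrier (PVT n)) (VT n)"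
  unfolding carrier_PVT by (rule group_hom.subgroup_kernel[OF VT_perm_group_hom])

interpretation PVT: group "PVT n"
  using subgroup.subgroup_is_group[OF PVT_subgroup VT.is_group] PVT_eq by metis

lemma lam_eq_lamb:
  assumes "(i, j) \<in> strand_pairs n"
  shows "lam n (i, j) = VT.lamb n i j"
proof -
  let ?w = "\<lambda>j. rev (map rg [i + 1..<j]) @ [sg i, rg i] @ map rg [i + 1..<j]"
  have mult: "VT_class n (u @ v) = VT_class n u \<otimes>\<^bsub>VT n\<^esub> VT_class n v"
    if "set u \<subseteq> VT_gens n \<times> UNIV" "set v \<subseteq> VT_gens n \<times> UNIV" for u v
    unfolding VT_def VT_class_def using that by (rule pres_class_mult[symmetric])
  have i: "1 \<le> i" "i < j" "j \<le> n" using assms by (auto simp: strand_pairs_def)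
  have "VT_class n (?w j) = VT.lamb n i j"
    using i(2,3)
  proof (induction j)
    case (Suc j)
    show ?case
    proof (cases "i = j")
      case True
      have "VT_class n ([sg i] @ [rg i]) = VT_class n [sg i] \<otimes>\<^bsub>VT n\<^esub> VT_class n [rg i]"
        by (rule mult) (use i in \<open>auto simp: VT_gens_def\<close>)
      then show ?thesis using True by (simp add: VT.lamb_adjacent)
    next
      case False
      then have ij: "i < j" using Suc.prems by simp
      then have w: "?w (Suc j) = [rg j] @ ?w j @ [rg j]" by simp
      have s: "set (?w j) \<subseteq> VT_gens n \<times> UNIV" "set [rg j] \<subseteq> VT_gens n \<times> UNIV"
        using ij Suc.prems i by (auto simp: VT_gens_def)
      have s': "set (?w j @ [rg j]) \<subseteq> VT_gens n \<times> UNIV" using s by simp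
      have "VT_class n (?w (Suc j)) =
          VT_class n [rg j] \<otimes>\<^bsub>VT n\<^esub> (VT_class n (?w j) \<otimes>\<^bsub>VT n\<^esub> VT_class n [rg j])"
        unfolding w mult[OF s(2) s'] mult[OF s] ..
      also have "\<dots> = VT.lamb n i (Suc j)"
        using Suc ij i by (simp add: VT.lamb_extend VT.m_assoc)
      finally show ?thesis .
    qed
  qed simp
  then show ?thesis by (simp add: lam_def)
qed

lemma lam_image: "lam n ` strand_pairs n = (\<lambda>(i, j). VT.lamb n i j) ` strand_pairs n"
  by (auto simp: lam_eq_lamb intro!: image_cong)

lemma lam_closed: "p \<in> strand_pairs n \<Longrightarrow> lam n p \<in> carrier (PVT n)"
proof (cases p)
  case (Pair i j)
  assume "p \<in> strand_pairs n"
  then have p: "(i, j) \<in> strand_pairs n" using Pair by simp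
  then have i: "1 \<le> i" "i < j" "j \<le> n" by (auto simp: strand_pairs_def)
  interpret V: group_hom "VT n" "sym_group n" "VT_perm n" by (rule VT_perm_group_hom)
  have "VT_perm n (VT.lamb n i j) = id"
    using i(2,3)
  proof (induction j)
    case (Suc j)
    then show ?case
    proof (cases "i = j")
      case True
      then show ?thesis using Suc.prems i(1) VT_perm_r[of i n] VT_perm_s[of i n]
        by (simp add: VT.lamb_adjacent sym_group_mult)
    next
      case False
      then have "VT.lamb n i j \<in> carrier (VT n)" using Suc.prems i by (intro VT.lamb_closed) auto
      then show ?thesis using False Suc i(1) VT_perm_r[of j n]
        by (simp add: VT.lamb_extend sym_group_mult)
    qed
  qed simp
  then show ?thesis
    using i unfolding Pair lam_eq_lamb[OF p] carrier_PVT by (simp add: kernel_def sym_group_one)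
qed

lemma lam_commute:
  assumes "(i, j) \<in> strand_pairs n" "(k, l) \<in> strand_pairs n" "distinct [i, j, k, l]"
  shows "lam n (i, j) \<otimes>\<^bsub>VT n\<^esub> lam n (k, l) = lam n (k, l) \<otimes>\<^bsub>VT n\<^esub> lam n (i, j)"
  unfolding lam_eq_lamb[OF assms(1)] lam_eq_lamb[OF assms(2)]
  using VT.Lam_commute[of i n j k l] assms by (simp add: VT.Lam_def strand_pairs_def)

text \<open>
  Write an element as a product of \<open>\<lambda>\<close>s times a word in the \<open>\<rho>\<^sub>i\<close>. The first factor is pure, so the
  second has trivial permutation and is \<open>1\<close> by \<open>coxeter_faithful\<close>.
\<close>

lemma PVT_generated: "carrier (PVT n) = generate (PVT n) (lam n ` strand_pairs n)"
proof
  interpret V: group_hom "VT n" "sym_group n" "VT_perm n" by (rule VT_perm_group_hom)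
  have sub: "lam n ` strand_pairs n \<subseteq> carrier (PVT n)" using lam_closed by auto
  have gen: "generate (PVT n) (lam n ` strand_pairs n) = generate (VT n) (lam n ` strand_pairs n)"
    using VT.generate_consistent[OF sub PVT_subgroup] PVT_eq by metis
  show "generate (PVT n) (lam n ` strand_pairs n) \<subseteq> carrier (PVT n)"
    by (rule PVT.generate_incl[OF sub])
  show "carrier (PVT n) \<subseteq> generate (PVT n) (lam n ` strand_pairs n)"
  proof
    fix x assume x: "x \<in> carrier (PVT n)"
    then have "x \<in> carrier (VT n)" using subgroup.subset[OF PVT_subgroup] by auto
    then have "x \<in> generate (VT n)
        ((\<lambda>i. VT_class n [sg i]) ` {1..<n} \<union> (\<lambda>i. VT_class n [rg i]) ` {1..<n})"
      using VT_generated by metis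
    from VT.generate_eq_lamb_times_r[OF this] obtain k w where
      k: "k \<in> generate (VT n) (lam n ` strand_pairs n)" and
      w: "w \<in> generate (VT n) ((\<lambda>i. VT_class n [rg i]) ` {1..<n})" and
      xkw: "x = k \<otimes>\<^bsub>VT n\<^esub> w"
      unfolding lam_image by blast
    have kP: "k \<in> carrier (PVT n)" using k PVT.generate_incl[OF sub] gen by auto
    have kc: "k \<in> carrier (VT n)" using kP subgroup.subset[OF PVT_subgroup] by auto
    have wc: "w \<in> carrier (VT n)"
      by (rule VT.generate_in_carrier[OF VT.r_closed_image[OF le_refl] w])
    have "VT_perm n w = id"
      using x kP kc wc unfolding carrier_PVT kernel_def xkw
      by (simp add: sym_group_mult sym_group_one)
    then have "w = \<one>\<^bsub>VT n\<^esub>"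
      by (intro VT.coxeter_faithful[OF VT_perm_hom VT_perm_r le_refl w]) auto
    then show "x \<in> generate (PVT n) (lam n ` strand_pairs n)" using k kc xkw gen by simp
  qed
qed

section \<open>The pure virtual twin group as a right-angled Artin group\<close>

definition far_commutators :: "nat \<Rightarrow> ((nat \<times> nat) word \<times> (nat \<times> nat) word) set"
  where "far_commutators n =
    {([((i, j), True), ((k, l), True)], [((k, l), True), ((i, j), True)]) | i j k l.
      (i, j) \<in> strand_pairs n \<and> (k, l) \<in> strand_pairs n \<and> distinct [i, j, k, l]}"

definition raag :: "nat \<Rightarrow> (nat \<times> nat) word set monoid"
  where "raag n = presented_group (strand_pairs n) (far_commutators n)"

definition vertex :: "nat \<Rightarrow> nat \<times> nat \<Rightarrow> (nat \<times> nat) word set"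
  where "vertex n p = pres_class (strand_pairs n) (far_commutators n) [(p, True)]"

definition signed_vertex :: "nat \<Rightarrow> nat \<Rightarrow> nat \<Rightarrow> (nat \<times> nat) word set"
  where "signed_vertex n a b = (if a < b then vertex n (a, b) else inv\<^bsub>raag n\<^esub> (vertex n (b, a)))"

lemma raag_presentation: "presentation (strand_pairs n) (far_commutators n)"
  by unfold_locales (auto simp: far_commutators_def)

interpretation raag: group "raag n"
  unfolding raag_def by (rule group_presented_group)

lemma vertex_closed [simp]: "p \<in> strand_pairs n \<Longrightarrow> vertex n p \<in> carrier (raag n)"
  using presentation.letter_closed[OF raag_presentation] by (auto simp: vertex_def raag_def)

lemma signed_vertex_closed [simp]:
  "a \<noteq> b \<Longrightarrow> a \<in> {1..n} \<Longrightarrow> b \<in> {1..n} \<Longrightarrow> signed_vertex n a b \<in> carrier (raag n)"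
  by (auto simp: signed_vertex_def strand_pairs_def)

lemma vertex_commute:
  assumes "(i, j) \<in> strand_pairs n" "(k, l) \<in> strand_pairs n" "distinct [i, j, k, l]"
  shows "vertex n (i, j) \<otimes>\<^bsub>raag n\<^esub> vertex n (k, l) = vertex n (k, l) \<otimes>\<^bsub>raag n\<^esub> vertex n (i, j)"
proof -
  have "([((i, j), True), ((k, l), True)], [((k, l), True), ((i, j), True)]) \<in> far_commutators n"
    using assms by (auto simp: far_commutators_def)
  from presentation.letter_rel[OF raag_presentation this] show ?thesis
    using assms vertex_closed[of _ n] by (simp flip: raag_def vertex_def)
qed

lemma inv_signed_vertex:
  "a \<noteq> b \<Longrightarrow> a \<in> {1..n} \<Longrightarrow> b \<in> {1..n} \<Longrightarrow> inv\<^bsub>raag n\<^esub> (signed_vertex n a b) = signed_vertex n b a"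
  by (auto simp: signed_vertex_def strand_pairs_def)

lemma signed_vertex_commute:
  assumes "a \<in> {1..n}" "b \<in> {1..n}" "c \<in> {1..n}" "d \<in> {1..n}" "distinct [a, b, c, d]"
  shows "signed_vertex n a b \<otimes>\<^bsub>raag n\<^esub> signed_vertex n c d = signed_vertex n c d \<otimes>\<^bsub>raag n\<^esub> signed_vertex n a b"
proof -
  have 1: "signed_vertex n a b \<otimes>\<^bsub>raag n\<^esub> signed_vertex n c d = signed_vertex n c d \<otimes>\<^bsub>raag n\<^esub> signed_vertex n a b"
    if "a < b" "c < d" "a \<in> {1..n}" "b \<in> {1..n}" "c \<in> {1..n}" "d \<in> {1..n}" "distinct [a, b, c, d]"
    for a b c d
    using vertex_commute[of a b n c d] that by (simp add: signed_vertex_def strand_pairs_def)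
  have 2: "signed_vertex n a b \<otimes>\<^bsub>raag n\<^esub> signed_vertex n c d = signed_vertex n c d \<otimes>\<^bsub>raag n\<^esub> signed_vertex n a b"
    if "c < d" "a \<in> {1..n}" "b \<in> {1..n}" "c \<in> {1..n}" "d \<in> {1..n}" "distinct [a, b, c, d]"
    for a b c d
  proof (cases "a < b")
    case False
    then have "inv\<^bsub>raag n\<^esub> (signed_vertex n b a) \<otimes>\<^bsub>raag n\<^esub> signed_vertex n c d =
        signed_vertex n c d \<otimes>\<^bsub>raag n\<^esub> inv\<^bsub>raag n\<^esub> (signed_vertex n b a)"
      using that by (intro raag.commute_inv 1) auto
    then show ?thesis using that inv_signed_vertex[of b a n] by simp
  qed (use 1 that in auto)
  show ?thesis
  proof (cases "c < d")
    case False
    then have "inv\<^bsub>raag n\<^esub> (signed_vertex n d c) \<otimes>\<^bsub>raag n\<^esub> signed_vertex n a b =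
        signed_vertex n a b \<otimes>\<^bsub>raag n\<^esub> inv\<^bsub>raag n\<^esub> (signed_vertex n d c)"
      using assms by (intro raag.commute_inv 2[symmetric]) auto
    then show ?thesis using assms inv_signed_vertex[of d c n] by simp
  next
    case True
    then show ?thesis by (rule 2) (use assms in auto)
  qed
qed

lemma raag_hom_exists:
  fixes G :: "('a, 'c) monoid_scheme"
  assumes G: "group G" and y: "\<And>p. p \<in> strand_pairs n \<Longrightarrow> y p \<in> carrier G"
    and comm: "\<And>i j k l. (i, j) \<in> strand_pairs n \<Longrightarrow> (k, l) \<in> strand_pairs n \<Longrightarrow> distinct [i, j, k, l] \<Longrightarrow>
      y (i, j) \<otimes>\<^bsub>G\<^esub> y (k, l) = y (k, l) \<otimes>\<^bsub>G\<^esub> y (i, j)"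
  obtains h where "h \<in> hom (raag n) G" "\<And>p. p \<in> strand_pairs n \<Longrightarrow> h (vertex n p) = y p"
proof -
  interpret G: group G by fact
  have y': "y \<in> strand_pairs n \<rightarrow> carrier G" using y by auto
  have rels: "word_val G y u = word_val G y v" if "(u, v) \<in> far_commutators n" for u v
    using that comm y by (auto simp: far_commutators_def)
  show thesis
    using presentation.presented_hom_exists[OF raag_presentation G y' rels] that
    unfolding raag_def vertex_def by metis
qed

lemma raag_hom_eq:
  assumes "group G" "f \<in> hom (raag n) G" "g \<in> hom (raag n) G"
    and "\<And>p. p \<in> strand_pairs n \<Longrightarrow> f (vertex n p) = g (vertex n p)" and "a \<in> carrier (raag n)"
  shows "f a = g a"
  using presentation.presented_hom_eq[OF raag_presentation, of G f n g a] assms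
  by (simp add: raag_def vertex_def)

text \<open>
  A permutation of the indices preserves disjointness of pairs, hence the relations of the
  right-angled Artin group, even when it reverses some pairs and so inverts some generators.
\<close>

lemma sym_action_raag:
  obtains \<phi> where "group_action_by_homs (raag n) (sym_group n) \<phi>"
    and "\<And>\<sigma> a b. \<sigma> permutes {1..n} \<Longrightarrow> a \<noteq> b \<Longrightarrow> a \<in> {1..n} \<Longrightarrow> b \<in> {1..n} \<Longrightarrow>
      \<phi> \<sigma> (signed_vertex n a b) = signed_vertex n (\<sigma> a) (\<sigma> b)"
proof -
  interpret P: presentation "strand_pairs n" "far_commutators n" by (rule raag_presentation)
  let ?y = "\<lambda>\<sigma> (i, j). signed_vertex n (\<sigma> i) (\<sigma> j)"
  have extend: "\<psi> (signed_vertex n a b) = signed_vertex n (\<sigma> a) (\<sigma> b)"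
    if \<psi>: "\<psi> \<in> hom (raag n) (raag n)" and v: "\<And>p. p \<in> strand_pairs n \<Longrightarrow> \<psi> (vertex n p) = ?y \<sigma> p"
      and \<sigma>: "\<sigma> permutes {1..n}" and ab: "a \<noteq> b" "a \<in> {1..n}" "b \<in> {1..n}" for \<psi> \<sigma> a b
  proof (cases "a < b")
    case True
    then show ?thesis using v[of "(a, b)"] ab by (simp add: signed_vertex_def strand_pairs_def)
  next
    case False
    interpret \<psi>: group_hom "raag n" "raag n" \<psi> 
      by (simp add: group_hom_def group_hom_axioms_def \<psi> raag.is_group)
    have ba: "(b, a) \<in> strand_pairs n" using False ab by (simp add: strand_pairs_def)
    have "\<psi> (signed_vertex n a b) = inv\<^bsub>raag n\<^esub> (signed_vertex n (\<sigma> b) (\<sigma> a))"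
      using False v[OF ba] ba by (simp add: signed_vertex_def[of n a b])
    also have "\<dots> = signed_vertex n (\<sigma> a) (\<sigma> b)"
      using ab permutes_in_image[OF \<sigma>] permutes_inj[OF \<sigma>]
      by (intro inv_signed_vertex) (auto dest: injD simp del: atLeastAtMost_iff)
    finally show ?thesis .
  qed
  have in_range: "\<sigma> a \<in> {1..n}" if "\<sigma> permutes {1..n}" "a \<in> {1..n}" for \<sigma> a
    using permutes_in_image[OF that(1)] that(2) by blast
  have ex: "\<exists>\<psi>\<in>hom (raag n) (raag n). \<forall>p\<in>strand_pairs n. \<psi> (vertex n p) = ?y \<sigma> p"
    if \<sigma>: "\<sigma> permutes {1..n}" for \<sigma>
  proof -
    have inj: "\<sigma> a = \<sigma> b \<longleftrightarrow> a = b" for a b using permutes_inj[OF \<sigma>] by (auto dest: injD)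
    have closed: "?y \<sigma> p \<in> carrier (raag n)" if "p \<in> strand_pairs n" for p
    proof -
      obtain i j where p: "p = (i, j)" "i \<noteq> j" "i \<in> {1..n}" "j \<in> {1..n}"
        using \<open>p \<in> strand_pairs n\<close> by (auto simp: strand_pairs_def)
      show ?thesis
        unfolding p(1) prod.case using p inj in_range[OF \<sigma>] by (intro signed_vertex_closed) blast+
    qed
    have commute: "?y \<sigma> (i, j) \<otimes>\<^bsub>raag n\<^esub> ?y \<sigma> (k, l) = ?y \<sigma> (k, l) \<otimes>\<^bsub>raag n\<^esub> ?y \<sigma> (i, j)"
      if "(i, j) \<in> strand_pairs n" "(k, l) \<in> strand_pairs n" "distinct [i, j, k, l]" for i j k l
    proof -
      have "i \<in> {1..n}" "j \<in> {1..n}" "k \<in> {1..n}" "l \<in> {1..n}"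
        using that by (auto simp: strand_pairs_def)
      note this[THEN in_range[OF \<sigma>]]
      moreover have "distinct [\<sigma> i, \<sigma> j, \<sigma> k, \<sigma> l]" using that(3) by (simp add: inj)
      ultimately show ?thesis unfolding prod.case by (rule signed_vertex_commute)
    qed
    show ?thesis
      by (rule raag_hom_exists[OF raag.is_group, of n "?y \<sigma>", OF closed commute]) blast+
  qed
  obtain \<phi> where
    hom: "\<And>\<sigma>. \<sigma> permutes {1..n} \<Longrightarrow> \<phi> \<sigma> \<in> hom (raag n) (raag n)"
    and val: "\<And>\<sigma> p. \<sigma> permutes {1..n} \<Longrightarrow> p \<in> strand_pairs n \<Longrightarrow> \<phi> \<sigma> (vertex n p) = ?y \<sigma> p"
    and one: "\<And>a. a \<in> carrier (raag n) \<Longrightarrow> \<phi> id a = a"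
    and mult: "\<And>\<sigma> \<tau> a. \<sigma> permutes {1..n} \<Longrightarrow> \<tau> permutes {1..n} \<Longrightarrow> a \<in> carrier (raag n) \<Longrightarrow>
      \<phi> (\<sigma> \<circ> \<tau>) a = \<phi> \<sigma> (\<phi> \<tau> a)"
  proof (rule P.presented_action_exists[OF sym_group_is_group[of n], of ?y,
        folded raag_def vertex_def, unfolded sym_group_carrier sym_group_mult sym_group_one])
    show "?y id p = vertex n p" if "p \<in> strand_pairs n" for p
      using that by (auto simp: signed_vertex_def strand_pairs_def)
    show "\<psi> (?y \<tau> p) = ?y (\<sigma> \<circ> \<tau>) p"
      if "\<sigma> permutes {1..n}" "\<tau> permutes {1..n}" "p \<in> strand_pairs n" "\<psi> \<in> hom (raag n) (raag n)"
        "\<And>p. p \<in> strand_pairs n \<Longrightarrow> \<psi> (vertex n p) = ?y \<sigma> p" for \<sigma> \<tau> \<psi> p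
    proof -
      obtain i j where p: "p = (i, j)" "i \<noteq> j" "i \<in> {1..n}" "j \<in> {1..n}"
        using \<open>p \<in> strand_pairs n\<close> by (auto simp: strand_pairs_def)
      have "\<tau> i \<noteq> \<tau> j" using permutes_inj[OF that(2)] p by (auto dest: injD)
      then show ?thesis
        using extend[OF that(4,5,1), of "\<tau> i" "\<tau> j"] in_range[OF that(2)] p by simp
    qed
  qed (use ex in auto)
  show thesis
  proof
    show "group_action_by_homs (raag n) (sym_group n) \<phi>"
      by (intro group_action_by_homs.intro group_action_by_homs_axioms.intro raag.is_group
          sym_group_is_group)
        (simp_all add: sym_group_carrier sym_group_mult sym_group_one hom one mult)
    show "\<phi> \<sigma> (signed_vertex n a b) = signed_vertex n (\<sigma> a) (\<sigma> b)"
      if "\<sigma> permutes {1..n}" "a \<noteq> b" "a \<in> {1..n}" "b \<in> {1..n}" for \<sigma> a b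
      by (rule extend[OF hom val]) (use that in auto)
  qed
qed

text \<open>
  The map from the right-angled Artin group exists because the relations hold in \<open>VT\<^sub>n\<close>, and it is onto
  because the \<open>\<lambda>\<^sub>i\<^sub>j\<close> generate. For injectivity, \<open>VT\<^sub>n\<close> is mapped to the semidirect product of the Artin
  group with the symmetric group; the composite is the inclusion of the first factor.
\<close>

lemma PVT_iso_raag:
  obtains \<alpha> where "\<alpha> \<in> iso (raag n) (PVT n)" "\<And>p. p \<in> strand_pairs n \<Longrightarrow> \<alpha> (vertex n p) = lam n p"
proof -
  obtain \<alpha> where \<alpha>: "\<alpha> \<in> hom (raag n) (PVT n)"
    and \<alpha>v: "\<And>p. p \<in> strand_pairs n \<Longrightarrow> \<alpha> (vertex n p) = lam n p"
    by (rule raag_hom_exists[OF PVT.is_group, of n "lam n" n]) (auto simp: lam_closed lam_commute)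
  obtain \<phi> where act: "group_action_by_homs (raag n) (sym_group n) \<phi>"
    and \<phi>: "\<And>\<sigma> a b. \<sigma> permutes {1..n} \<Longrightarrow> a \<noteq> b \<Longrightarrow> a \<in> {1..n} \<Longrightarrow> b \<in> {1..n} \<Longrightarrow>
      \<phi> \<sigma> (signed_vertex n a b) = signed_vertex n (\<sigma> a) (\<sigma> b)"
    using sym_action_raag by blast
  interpret A: group_action_by_homs "raag n" "sym_group n" \<phi> by (rule act)
  interpret S: vt_system "sym_group n" n "\<lambda>i. transpose i (i + 1)" "\<lambda>i. transpose i (i + 1)"
    by (rule sym_system)
  let ?S = "sdp (raag n) (sym_group n) \<phi>"
  let ?t = "\<lambda>i. transpose i (i + 1) :: nat \<Rightarrow> nat"
  let ?v = "\<lambda>i. vertex n (i, i + 1)"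
  have t: "?t i \<in> carrier (sym_group n)" if "1 \<le> i" "i < n" for i
    using S.r_closed that by blast
  have tp: "?t i permutes {1..n}" if "1 \<le> i" "i < n" for i
    using t[OF that] by (simp add: sym_group_carrier)
  have pair: "(i, i + 1) \<in> strand_pairs n" if "1 \<le> i" "i < n" for i
    using that by (simp add: strand_pairs_def)
  have v: "?v i \<in> carrier (raag n)" if "1 \<le> i" "i < n" for i
    using pair[OF that] by (rule vertex_closed)
  have \<phi>_pair: "\<phi> \<sigma> (vertex n (i, j)) = signed_vertex n (\<sigma> i) (\<sigma> j)"
    if "\<sigma> permutes {1..n}" "(i, j) \<in> strand_pairs n" for \<sigma> i j
    using \<phi>[OF that(1), of i j] that(2) by (simp add: signed_vertex_def strand_pairs_def)
  have far: "\<phi> (?t i) (?v j) = ?v j"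
    if "1 \<le> i" "i < n" "1 \<le> j" "j < n" "i + 2 \<le> j \<or> j + 2 \<le> i" for i j
    unfolding \<phi>_pair[OF tp[OF that(1,2)] pair[OF that(3,4)]]
    using that(5) by (auto simp: transpose_def signed_vertex_def)
  have sys: "vt_system ?S n (\<lambda>i. (\<one>\<^bsub>raag n\<^esub>, ?t i)) (\<lambda>i. (?v i, ?t i))"
  proof (intro vt_system.intro coxeter_system.intro coxeter_system_axioms.intro
      vt_system_axioms.intro A.group_sdp)
    show "(?v i, ?t i) \<otimes>\<^bsub>?S\<^esub> (?v i, ?t i) = \<one>\<^bsub>?S\<^esub>" if i: "1 \<le> i" "i < n" for i
    proof -
      have "\<phi> (?t i) (?v i) = signed_vertex n (i + 1) i"
        unfolding \<phi>_pair[OF tp[OF i] pair[OF i]] by simp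
      also have "\<dots> = inv\<^bsub>raag n\<^esub> (?v i)" by (simp add: signed_vertex_def)
      finally show ?thesis using v[OF i] S.r_square[OF i] by simp
    qed
    show "(?v i, ?t i) \<otimes>\<^bsub>?S\<^esub> (?v j, ?t j) = (?v j, ?t j) \<otimes>\<^bsub>?S\<^esub> (?v i, ?t i)"
      if ij: "1 \<le> i" "i < n" "1 \<le> j" "j < n" "i + 2 \<le> j \<or> j + 2 \<le> i" for i j
    proof -
      have "?v i \<otimes>\<^bsub>raag n\<^esub> ?v j = ?v j \<otimes>\<^bsub>raag n\<^esub> ?v i"
        using ij by (intro vertex_commute pair) auto
      moreover have "\<phi> (?t j) (?v i) = ?v i" using ij by (intro far) auto
      ultimately show ?thesis using far[OF ij] S.r_commute[OF ij] by simp
    qed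
    show "(\<one>\<^bsub>raag n\<^esub>, ?t i) \<otimes>\<^bsub>?S\<^esub> (?v j, ?t j) = (?v j, ?t j) \<otimes>\<^bsub>?S\<^esub> (\<one>\<^bsub>raag n\<^esub>, ?t i)"
      if ij: "1 \<le> i" "i < n" "1 \<le> j" "j < n" "i + 2 \<le> j \<or> j + 2 \<le> i" for i j
      using far[OF ij] S.r_commute[OF ij] v[OF ij(3,4)] A.act_unit[OF t[OF ij(3,4)]] by simp
    show "(\<one>\<^bsub>raag n\<^esub>, ?t i) \<otimes>\<^bsub>?S\<^esub> (\<one>\<^bsub>raag n\<^esub>, ?t (i + 1)) \<otimes>\<^bsub>?S\<^esub> (?v i, ?t i) =
      (?v (i + 1), ?t (i + 1)) \<otimes>\<^bsub>?S\<^esub> (\<one>\<^bsub>raag n\<^esub>, ?t i) \<otimes>\<^bsub>?S\<^esub> (\<one>\<^bsub>raag n\<^esub>, ?t (i + 1))"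
      if i: "1 \<le> i" "i + 1 < n" for i
    proof -
      have i': "i < n" "1 \<le> i + 1" using i by auto
      note c = t[OF i(1) i'(1)] t[OF i'(2) i(2)]
      have p: "?t i \<circ> ?t (i + 1) permutes {1..n}"
        using permutes_compose[OF tp[OF i'(2) i(2)] tp[OF i(1) i'(1)]] .
      have "\<phi> (?t i \<circ> ?t (i + 1)) (?v i) = signed_vertex n (i + 1) (i + 2)"
        unfolding \<phi>_pair[OF p pair[OF i(1) i'(1)]] by (simp add: transpose_def)
      also have "\<dots> = ?v (i + 1)" by (simp add: signed_vertex_def)
      finally have "\<phi> (?t i \<otimes>\<^bsub>sym_group n\<^esub> ?t (i + 1)) (?v i) = ?v (i + 1)"
        by (simp add: sym_group_mult)
      then show ?thesis
        using c v[OF i'(2) i(2)] S.mixed[OF i] A.act_unit by simp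
    qed
    show "(\<one>\<^bsub>raag n\<^esub>, ?t i) \<otimes>\<^bsub>?S\<^esub> (\<one>\<^bsub>raag n\<^esub>, ?t (i + 1)) \<otimes>\<^bsub>?S\<^esub> (\<one>\<^bsub>raag n\<^esub>, ?t i) =
      (\<one>\<^bsub>raag n\<^esub>, ?t (i + 1)) \<otimes>\<^bsub>?S\<^esub> (\<one>\<^bsub>raag n\<^esub>, ?t i) \<otimes>\<^bsub>?S\<^esub> (\<one>\<^bsub>raag n\<^esub>, ?t (i + 1))"
      if i: "1 \<le> i" "i + 1 < n" for i
      using t[of i] t[of "i + 1"] i S.r_braid[OF i] A.act_unit by simp
    show "(\<one>\<^bsub>raag n\<^esub>, ?t i) \<otimes>\<^bsub>?S\<^esub> (\<one>\<^bsub>raag n\<^esub>, ?t i) = \<one>\<^bsub>?S\<^esub>" if "1 \<le> i" "i < n" for i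
      using t[OF that] S.r_square[OF that] A.act_unit by simp
    show "(\<one>\<^bsub>raag n\<^esub>, ?t i) \<otimes>\<^bsub>?S\<^esub> (\<one>\<^bsub>raag n\<^esub>, ?t j) = (\<one>\<^bsub>raag n\<^esub>, ?t j) \<otimes>\<^bsub>?S\<^esub> (\<one>\<^bsub>raag n\<^esub>, ?t i)"
      if ij: "1 \<le> i" "i < n" "1 \<le> j" "j < n" "i + 2 \<le> j \<or> j + 2 \<le> i" for i j
      using t[OF ij(1,2)] t[OF ij(3,4)] S.r_commute[OF ij] A.act_unit by simp
  qed (use t v in auto)
  obtain \<beta> where \<beta>: "\<beta> \<in> hom (VT n) ?S"
    and \<beta>r: "\<And>i. 1 \<le> i \<Longrightarrow> i < n \<Longrightarrow> \<beta> (VT_class n [rg i]) = (\<one>\<^bsub>raag n\<^esub>, ?t i)"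
    and \<beta>s: "\<And>i. 1 \<le> i \<Longrightarrow> i < n \<Longrightarrow> \<beta> (VT_class n [sg i]) = (?v i, ?t i)"
    using VT_hom_exists[OF sys] by blast
  interpret \<beta>: group_hom "VT n" ?S \<beta>
    by (simp add: group_hom_def group_hom_axioms_def \<beta> VT.is_group A.group_sdp)
  have tt: "?t i \<otimes>\<^bsub>sym_group n\<^esub> ?t i = \<one>\<^bsub>sym_group n\<^esub>" for i by (simp add: sym_group_def)
  have lamb: "\<beta> (VT.lamb n i j) = (vertex n (i, j), \<one>\<^bsub>sym_group n\<^esub>)" if "1 \<le> i" "i < j" "j \<le> n" for i j
    using that(2,3)
  proof (induction j)
    case (Suc j)
    show ?case
    proof (cases "i = j")
      case True
      have "\<beta> (VT.lamb n i (Suc i)) = (?v i, ?t i) \<otimes>\<^bsub>?S\<^esub> (\<one>\<^bsub>raag n\<^esub>, ?t i)"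
        unfolding VT.lamb_adjacent using \<beta>s[of i] \<beta>r[of i] that True Suc.prems by simp
      then show ?thesis
        using t[of i] v[of i] that True Suc.prems A.act_unit tt by simp
    next
      case False
      then have ij: "i < j" "j \<le> n" "j < n" "1 \<le> j" "(i, j) \<in> strand_pairs n"
        using Suc.prems that by (auto simp: strand_pairs_def)
      have "VT.lamb n i j \<in> carrier (VT n)" using ij that by (intro VT.lamb_closed) auto
      moreover have "VT_class n [rg j] \<in> carrier (VT n)" using ij by (intro VT.r_closed) auto
      ultimately have "\<beta> (VT.lamb n i (Suc j)) =
        (\<one>\<^bsub>raag n\<^esub>, ?t j) \<otimes>\<^bsub>?S\<^esub> (vertex n (i, j), \<one>\<^bsub>sym_group n\<^esub>) \<otimes>\<^bsub>?S\<^esub> (\<one>\<^bsub>raag n\<^esub>, ?t j)"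
        unfolding VT.lamb_extend[OF ij(1)] using \<beta>r[OF ij(4,3)] Suc.IH ij by simp
      also have "\<dots> = (\<phi> (?t j) (vertex n (i, j)), \<one>\<^bsub>sym_group n\<^esub>)"
        using t[OF ij(4,3)] vertex_closed[OF ij(5)] A.act_unit[OF t[OF ij(4,3)]] tt by simp
      also have "\<phi> (?t j) (vertex n (i, j)) = vertex n (i, Suc j)"
        unfolding \<phi>_pair[OF tp[OF ij(4,3)] ij(5)] using ij(1) by (auto simp: signed_vertex_def transpose_def)
      finally show ?thesis .
    qed
  qed simp
  have \<alpha>VT: "\<alpha> \<in> hom (raag n) (VT n)"
    using \<alpha> subgroup.subset[OF PVT_subgroup] by (auto simp: hom_def)
  have \<beta>\<alpha>: "\<beta> (\<alpha> x) = (x, \<one>\<^bsub>sym_group n\<^esub>)" if "x \<in> carrier (raag n)" for x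
  proof -
    have "(\<beta> \<circ> \<alpha>) x = (x, \<one>\<^bsub>sym_group n\<^esub>)"
    proof (rule raag_hom_eq[OF A.group_sdp _ A.sdp_incl_fst _ that])
      show "\<beta> \<circ> \<alpha> \<in> hom (raag n) ?S" using \<alpha>VT \<beta> by (rule hom_compose)
      show "(\<beta> \<circ> \<alpha>) (vertex n p) = (vertex n p, \<one>\<^bsub>sym_group n\<^esub>)" if "p \<in> strand_pairs n" for p
        using that lamb by (cases p) (auto simp: \<alpha>v lam_eq_lamb strand_pairs_def)
    qed
    then show ?thesis by simp
  qed
  have inj: "inj_on \<alpha> (carrier (raag n))"
    by (rule inj_onI) (metis \<beta>\<alpha> prod.inject)
  have "\<alpha> ` carrier (raag n) = carrier (PVT n)"
  proof
    show "\<alpha> ` carrier (raag n) \<subseteq> carrier (PVT n)" using \<alpha> by (auto simp: hom_def)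
    interpret \<alpha>: group_hom "raag n" "PVT n" \<alpha>
      by (simp add: group_hom_def group_hom_axioms_def \<alpha> raag.is_group PVT.is_group)
    have "lam n ` strand_pairs n \<subseteq> \<alpha> ` carrier (raag n)"
      using \<alpha>v vertex_closed by (metis (no_types, opaque_lifting) image_eqI image_subsetI)
    then show "carrier (PVT n) \<subseteq> \<alpha> ` carrier (raag n)"
      unfolding PVT_generated by (rule PVT.generate_subgroup_incl[OF _ \<alpha>.img_is_subgroup])
  qed
  then have "\<alpha> \<in> iso (raag n) (PVT n)" using inj \<alpha> by (simp add: iso_iff)
  then show thesis using \<alpha>v that by blast
qed

text \<open>
  The isomorphism with the right-angled Artin group, restated as a universal property of \<open>PVT\<^sub>n\<close>.
\<close>

lemma PVT_hom_exists:
  fixes G :: "('a, 'c) monoid_scheme"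
  assumes G: "group G" and y: "\<And>p. p \<in> strand_pairs n \<Longrightarrow> y p \<in> carrier G"
    and comm: "\<And>i j k l. (i, j) \<in> strand_pairs n \<Longrightarrow> (k, l) \<in> strand_pairs n \<Longrightarrow> distinct [i, j, k, l] \<Longrightarrow>
      y (i, j) \<otimes>\<^bsub>G\<^esub> y (k, l) = y (k, l) \<otimes>\<^bsub>G\<^esub> y (i, j)"
  obtains h where "h \<in> hom (PVT n) G" "\<And>p. p \<in> strand_pairs n \<Longrightarrow> h (lam n p) = y p"
proof -
  obtain h where h: "h \<in> hom (raag n) G" "\<And>p. p \<in> strand_pairs n \<Longrightarrow> h (vertex n p) = y p"
    by (rule raag_hom_exists[OF G, of n y, OF y comm]) blast+
  obtain \<alpha> where \<alpha>: "\<alpha> \<in> iso (raag n) (PVT n)" "\<And>p. p \<in> strand_pairs n \<Longrightarrow> \<alpha> (vertex n p) = lam n p"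
    using PVT_iso_raag by blast
  let ?\<gamma> = "inv_into (carrier (raag n)) \<alpha>"
  have "?\<gamma> \<in> hom (PVT n) (raag n)"
    using raag.iso_set_sym[OF \<alpha>(1)] by (simp add: iso_def)
  then have "h \<circ> ?\<gamma> \<in> hom (PVT n) G" using h(1) by (rule hom_compose)
  moreover have "(h \<circ> ?\<gamma>) (lam n p) = y p" if p: "p \<in> strand_pairs n" for p
  proof -
    have "?\<gamma> (\<alpha> (vertex n p)) = vertex n p"
      using \<alpha>(1) vertex_closed[OF p] by (intro inv_into_f_f) (auto simp: iso_def bij_betw_def)
    then show ?thesis using \<alpha>(2)[OF p] h(2)[OF p] by simp
  qed
  ultimately show thesis by (rule that)
qed

lemma PVT_hom_eq:
  assumes "group G" "f \<in> hom (PVT n) G" "g \<in> hom (PVT n) G"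
    and "\<And>p. p \<in> strand_pairs n \<Longrightarrow> f (lam n p) = g (lam n p)" and "a \<in> carrier (PVT n)"
  shows "f a = g a"
proof (rule hom_eq_on_generate[OF PVT.is_group assms(1-3)])
  show "lam n ` strand_pairs n \<subseteq> carrier (PVT n)" using lam_closed by auto
  show "a \<in> generate (PVT n) (lam n ` strand_pairs n)" using assms(5) PVT_generated by simp
qed (use assms(4) in auto)

lemma PVT_hom_on_gens:
  fixes G :: "('a, 'c) monoid_scheme"
  assumes G: "group G" and y: "\<And>p. p \<in> strand_pairs n \<Longrightarrow> y p \<in> carrier G"
    and comm: "\<And>i j k l. (i, j) \<in> strand_pairs n \<Longrightarrow> (k, l) \<in> strand_pairs n \<Longrightarrow> distinct [i, j, k, l] \<Longrightarrow>
      y (i, j) \<otimes>\<^bsub>G\<^esub> y (k, l) = y (k, l) \<otimes>\<^bsub>G\<^esub> y (i, j)"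
  shows "hom_on_gens (PVT n) G (strand_pairs n) (lam n) y \<in> hom (PVT n) G"
    and "p \<in> strand_pairs n \<Longrightarrow> hom_on_gens (PVT n) G (strand_pairs n) (lam n) y (lam n p) = y p"
proof -
  obtain h where h: "h \<in> hom (PVT n) G" "\<And>p. p \<in> strand_pairs n \<Longrightarrow> h (lam n p) = y p"
    by (rule PVT_hom_exists[OF G, of n y, OF y comm]) blast+
  have sub: "lam n ` strand_pairs n \<subseteq> carrier (PVT n)" using lam_closed by auto
  have e: "hom_on_gens (PVT n) G (strand_pairs n) (lam n) y = restrict h (carrier (PVT n))"
    by (rule hom_on_gens_eq_restrict[OF PVT.is_group G sub PVT_generated h])
  show "hom_on_gens (PVT n) G (strand_pairs n) (lam n) y \<in> hom (PVT n) G"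
    using PVT.restrict_in_hom[OF h(1)] by (simp add: e)
  show "hom_on_gens (PVT n) G (strand_pairs n) (lam n) y (lam n p) = y p" if "p \<in> strand_pairs n"
    using h(2) lam_closed that by (simp add: e)
qed

text \<open>
  Below, \<open>PVT\<^sub>n\<close> is treated as a group in its own right; rewriting its operations into those of
  \<open>VT\<^sub>n\<close> would only hide the group laws from the simplifier.
\<close>

declare PVT_simps [simp del]

section \<open>Forgetting a strand\<close>

lemma strand_pairs_pred: "p \<in> strand_pairs (n - 1) \<Longrightarrow> p \<in> strand_pairs n"
  by (auto simp: strand_pairs_def)

lemma lam_commute_PVT:
  assumes "(i, j) \<in> strand_pairs n" "(k, l) \<in> strand_pairs n" "distinct [i, j, k, l]"
  shows "lam n (i, j) \<otimes>\<^bsub>PVT n\<^esub> lam n (k, l) = lam n (k, l) \<otimes>\<^bsub>PVT n\<^esub> lam n (i, j)"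
  using lam_commute[OF assms] by (simp add: PVT_simps)

lemma forget_strand:
  shows forget_strand_hom: "forget_strand n \<in> hom (PVT n) (PVT (n - 1))"
    and forget_strand_lam: "(i, j) \<in> strand_pairs n \<Longrightarrow>
      forget_strand n (lam n (i, j)) = (if j \<noteq> n then lam (n - 1) (i, j) else \<one>\<^bsub>PVT (n - 1)\<^esub>)"
proof -
  let ?y = "\<lambda>(i, j). if j \<noteq> n then lam (n - 1) (i, j) else \<one>\<^bsub>PVT (n - 1)\<^esub>"
  have low: "(i, j) \<in> strand_pairs (n - 1)" if "(i, j) \<in> strand_pairs n" "j \<noteq> n" for i j
    using that by (auto simp: strand_pairs_def)
  have y: "?y p \<in> carrier (PVT (n - 1))" if "p \<in> strand_pairs n" for p
  proof (cases p)
    case (Pair i j)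
    then show ?thesis using that lam_closed[OF low, of i j] by auto
  qed
  have comm: "?y (i, j) \<otimes>\<^bsub>PVT (n - 1)\<^esub> ?y (k, l) = ?y (k, l) \<otimes>\<^bsub>PVT (n - 1)\<^esub> ?y (i, j)"
    if "(i, j) \<in> strand_pairs n" "(k, l) \<in> strand_pairs n" "distinct [i, j, k, l]" for i j k l
    using lam_commute_PVT[of i j "n - 1" k l] that low lam_closed[OF low, of i j] lam_closed[OF low, of k l]
    by (auto)
  note props = PVT_hom_on_gens[OF PVT.is_group, of n ?y, OF y comm, folded forget_strand_def]
  show "forget_strand n \<in> hom (PVT n) (PVT (n - 1))"
    by (rule props(1)) blast+
  show "forget_strand n (lam n (i, j)) = (if j \<noteq> n then lam (n - 1) (i, j) else \<one>\<^bsub>PVT (n - 1)\<^esub>)"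
    if "(i, j) \<in> strand_pairs n"
    using props(2)[OF _ _ _ _ that] by simp
qed

lemma add_strand:
  shows add_strand_hom: "add_strand n \<in> hom (PVT (n - 1)) (PVT n)"
    and add_strand_lam: "p \<in> strand_pairs (n - 1) \<Longrightarrow> add_strand n (lam (n - 1) p) = lam n p"
proof -
  note props = PVT_hom_on_gens[OF PVT.is_group, of "n - 1" "lam n" n,
      OF lam_closed[OF strand_pairs_pred] lam_commute_PVT[OF strand_pairs_pred strand_pairs_pred],
      folded add_strand_def]
  show "add_strand n \<in> hom (PVT (n - 1)) (PVT n)"
    by (rule props(1)) blast+
  show "add_strand n (lam (n - 1) p) = lam n p" if "p \<in> strand_pairs (n - 1)"
    by (rule props(2)[OF _ _ _ _ that]) blast+
qed

lemma forget_add_strand: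
  assumes "x \<in> carrier (PVT (n - 1))"
  shows "forget_strand n (add_strand n x) = x"
proof -
  have "(forget_strand n \<circ> add_strand n) x = id x"
  proof (rule PVT_hom_eq[OF PVT.is_group _ _ _ assms])
    show "forget_strand n \<circ> add_strand n \<in> hom (PVT (n - 1)) (PVT (n - 1))"
      using add_strand_hom forget_strand_hom by (rule hom_compose)
    show "id \<in> hom (PVT (n - 1)) (PVT (n - 1))" by (simp add: hom_def)
    show "(forget_strand n \<circ> add_strand n) (lam (n - 1) p) = id (lam (n - 1) p)"
      if "p \<in> strand_pairs (n - 1)" for p
    proof -
      obtain i j where p: "p = (i, j)" "(i, j) \<in> strand_pairs n" "j \<noteq> n"
        using \<open>p \<in> strand_pairs (n - 1)\<close> by (cases p) (auto simp: strand_pairs_def)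
      show ?thesis
        unfolding comp_apply add_strand_lam[OF that] id_apply using p forget_strand_lam[OF p(2)] by simp
    qed
  qed
  then show ?thesis by simp
qed

section \<open>Split extensions\<close>

text \<open>
  Associativity and inverses can be transported along an isomorphism, but closure cannot: membership
  of \<open>d\<close> in \<open>iso L G\<close> does not say that products in \<open>L\<close> stay in its carrier.
\<close>

lemma (in group) group_if_iso:
  assumes d: "d \<in> iso L G"
    and closed: "\<And>x y. x \<in> carrier L \<Longrightarrow> y \<in> carrier L \<Longrightarrow> x \<otimes>\<^bsub>L\<^esub> y \<in> carrier L"
    and one: "\<one>\<^bsub>L\<^esub> \<in> carrier L" "d \<one>\<^bsub>L\<^esub> = \<one>"
  shows "group L"
proof (rule groupI)
  have mult: "d (x \<otimes>\<^bsub>L\<^esub> y) = d x \<otimes> d y" if "x \<in> carrier L" "y \<in> carrier L" for x y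
    using d that by (auto simp: iso_def hom_def)
  have dc: "d x \<in> carrier G" if "x \<in> carrier L" for x
    using d that by (auto simp: iso_def hom_def)
  have inj: "x = y" if "d x = d y" "x \<in> carrier L" "y \<in> carrier L" for x y
    using d that by (auto simp: iso_def bij_betw_def dest: inj_onD)
  fix x assume x: "x \<in> carrier L"
  show "\<one>\<^bsub>L\<^esub> \<otimes>\<^bsub>L\<^esub> x = x" by (rule inj) (simp_all add: x one closed mult dc)
  have "inv (d x) \<in> d ` carrier L" using d x dc by (simp add: iso_def bij_betw_def)
  then obtain y where y: "y \<in> carrier L" "d y = inv (d x)" by (metis imageE)
  have "y \<otimes>\<^bsub>L\<^esub> x = \<one>\<^bsub>L\<^esub>" by (rule inj) (simp_all add: x y one closed mult dc)
  then show "\<exists>y\<in>carrier L. y \<otimes>\<^bsub>L\<^esub> x = \<one>\<^bsub>L\<^esub>" using y by blast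
  fix y z assume yz: "y \<in> carrier L" "z \<in> carrier L"
  show "x \<otimes>\<^bsub>L\<^esub> y \<otimes>\<^bsub>L\<^esub> z = x \<otimes>\<^bsub>L\<^esub> (y \<otimes>\<^bsub>L\<^esub> z)"
    by (rule inj) (simp_all add: x yz closed mult dc m_assoc)
qed (use closed one in auto)

text \<open>
  A homomorphism with a section. The image of the section is the complement of the kernel in the
  semidirect product decomposition.
\<close>

locale split_extension = G: group G + H: group H
  for G :: "('a, 'c) monoid_scheme" (structure) and H :: "('b, 'd) monoid_scheme" (structure) +
  fixes f :: "'a \<Rightarrow> 'b" and i :: "'b \<Rightarrow> 'a"
  assumes f_hom: "f \<in> hom G H" and i_hom: "i \<in> hom H G"
    and f_i [simp]: "h \<in> carrier H \<Longrightarrow> f (i h) = h"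
begin

sublocale f: group_hom G H f
  by (simp add: group_hom_def group_hom_axioms_def f_hom G.is_group H.is_group)

sublocale i: group_hom H G i
  by (simp add: group_hom_def group_hom_axioms_def i_hom G.is_group H.is_group)

abbreviation K :: "'a set"
  where "K \<equiv> kernel G H f"

abbreviation N :: "('a, 'c) monoid_scheme"
  where "N \<equiv> G\<lparr>carrier := K\<rparr>"

lemma K_iff: "x \<in> K \<longleftrightarrow> x \<in> carrier G \<and> f x = \<one>\<^bsub>H\<^esub>"
  by (simp add: kernel_def)

lemma K_closed: "x \<in> K \<Longrightarrow> x \<in> carrier G"
  by (simp add: K_iff)

lemma group_N: "group N"
  by (rule subgroup.subgroup_is_group[OF f.subgroup_kernel G.is_group])

lemma K_mult: "x \<in> K \<Longrightarrow> y \<in> K \<Longrightarrow> x \<otimes>\<^bsub>G\<^esub> y \<in> K"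
  by (simp add: K_iff)

lemma K_conj: "c \<in> carrier G \<Longrightarrow> x \<in> K \<Longrightarrow> c \<otimes>\<^bsub>G\<^esub> x \<otimes>\<^bsub>G\<^esub> inv\<^bsub>G\<^esub> c \<in> K"
  by (simp add: K_iff)

definition cnj :: "'a \<Rightarrow> 'a \<Rightarrow> 'a"
  where "cnj c = (\<lambda>x \<in> K. c \<otimes>\<^bsub>G\<^esub> x \<otimes>\<^bsub>G\<^esub> inv\<^bsub>G\<^esub> c)"

lemma cnj_auto:
  assumes c: "c \<in> carrier G"
  shows "cnj c \<in> auto N"
proof -
  have "cnj c \<in> hom N N"
  proof (rule homI)
    show "cnj c x \<in> carrier N" if "x \<in> carrier N" for x
      using that c K_conj by (simp add: cnj_def)
    show "cnj c (x \<otimes>\<^bsub>N\<^esub> y) = cnj c x \<otimes>\<^bsub>N\<^esub> cnj c y" if "x \<in> carrier N" "y \<in> carrier N" for x y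
      using that c by (simp add: cnj_def K_mult K_closed G.m_assoc)
  qed
  moreover have "bij_betw (cnj c) K K"
  proof (rule bij_betw_byWitness[where f' = "cnj (inv\<^bsub>G\<^esub> c)"])
    show "\<forall>x\<in>K. cnj (inv\<^bsub>G\<^esub> c) (cnj c x) = x" "\<forall>x\<in>K. cnj c (cnj (inv\<^bsub>G\<^esub> c) x) = x"
      using c K_conj[OF c] K_conj[OF G.inv_closed[OF c]]
      by (auto simp: cnj_def K_closed G.m_assoc)
    show "cnj c ` K \<subseteq> K" "cnj (inv\<^bsub>G\<^esub> c) ` K \<subseteq> K"
      using c K_conj[OF c] K_conj[OF G.inv_closed[OF c]] by (auto simp: cnj_def)
  qed
  ultimately show ?thesis by (simp add: auto_def Bij_def cnj_def)
qed

lemma cnj_hom: "cnj \<in> hom G (AutoGroup N)"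
proof (rule homI)
  show "cnj c \<in> carrier (AutoGroup N)" if "c \<in> carrier G" for c
    using cnj_auto[OF that] by (simp add: AutoGroup_def)
  fix c e assume c: "c \<in> carrier G" and e: "e \<in> carrier G"
  have B: "cnj c \<in> Bij K" "cnj e \<in> Bij K" using cnj_auto c e by (auto simp: auto_def)
  have "cnj (c \<otimes>\<^bsub>G\<^esub> e) = compose K (cnj c) (cnj e)"
    using c e K_conj[OF e]
    by (auto simp: cnj_def compose_def K_closed G.m_assoc G.inv_mult_group intro!: restrict_ext)
  also have "\<dots> = cnj c \<otimes>\<^bsub>AutoGroup N\<^esub> cnj e" using B by (simp add: AutoGroup_def BijGroup_def)
  finally show "cnj (c \<otimes>\<^bsub>G\<^esub> e) = cnj c \<otimes>\<^bsub>AutoGroup N\<^esub> cnj e" .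
qed

lemma conj_action_hom:
  assumes d: "d \<in> hom L H"
  shows "(\<lambda>k. cnj (i (d k))) \<in> hom L (AutoGroup N)"
proof -
  have "cnj \<circ> (i \<circ> d) \<in> hom L (AutoGroup N)"
    using hom_compose[OF hom_compose[OF d i_hom] cnj_hom] .
  then show ?thesis by (simp add: comp_def)
qed

text \<open>
  Every \<open>x\<close> is uniquely an element of the kernel times an element of the section, the latter being
  \<open>i (f x)\<close>. The isomorphism \<open>d\<close> allows the complement to be given in another encoding.
\<close>

lemma semidirect_iso:
  assumes d: "d \<in> iso L H"
  shows "(\<lambda>x. hd x \<otimes>\<^bsub>G\<^esub> i (d (tl x))) \<in> iso (semidirect N L (\<lambda>k. cnj (i (d k)))) G"
    (is "?e \<in> iso ?S G")
proof -
  have dc: "d k \<in> carrier H" if "k \<in> carrier L" for k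
    using d that by (auto simp: iso_def hom_def)
  have dm: "d (k \<otimes>\<^bsub>L\<^esub> l) = d k \<otimes>\<^bsub>H\<^esub> d l" if "k \<in> carrier L" "l \<in> carrier L" for k l
    using d that by (auto simp: iso_def hom_def)
  have d_inj: "inj_on d (carrier L)" and d_surj: "d ` carrier L = carrier H"
    using d by (auto simp: iso_def bij_betw_def)
  have f_e: "f (u \<otimes>\<^bsub>G\<^esub> i (d k)) = d k" if "u \<in> K" "k \<in> carrier L" for u k
    using that dc by (simp add: K_iff)
  have hom: "?e \<in> hom ?S G"
  proof (rule homI)
    show "?e x \<in> carrier G" if "x \<in> carrier ?S" for x
      using that dc by (auto simp: semidirect_def K_closed)
    fix x y assume "x \<in> carrier ?S" "y \<in> carrier ?S"
    then obtain u k v l where xy: "x = u # k" "y = v # l"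
      and uv: "u \<in> K" "v \<in> K" "k \<in> carrier L" "l \<in> carrier L"
      by (auto simp: semidirect_def)
    then show "?e (x \<otimes>\<^bsub>?S\<^esub> y) = ?e x \<otimes>\<^bsub>G\<^esub> ?e y"
      using dc by (simp add: semidirect_def cnj_def dm K_closed G.m_assoc)
  qed
  have "inj_on ?e (carrier ?S)"
  proof (rule inj_onI)
    fix x y assume "x \<in> carrier ?S" "y \<in> carrier ?S" and eq: "?e x = ?e y"
    then obtain u k v l where xy: "x = u # k" "y = v # l"
      and uv: "u \<in> K" "v \<in> K" "k \<in> carrier L" "l \<in> carrier L"
      by (auto simp: semidirect_def)
    have e: "u \<otimes>\<^bsub>G\<^esub> i (d k) = v \<otimes>\<^bsub>G\<^esub> i (d l)" using eq xy by simp
    then have "d k = d l" using f_e uv by metis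
    then have "k = l" using d_inj uv by (auto dest: inj_onD)
    moreover have "u = v" using e uv dc \<open>k = l\<close> by (simp add: K_closed)
    ultimately show "x = y" using xy by simp
  qed
  moreover have "?e ` carrier ?S = carrier G"
  proof
    show "?e ` carrier ?S \<subseteq> carrier G" using hom by (auto simp: hom_def)
    show "carrier G \<subseteq> ?e ` carrier ?S"
    proof
      fix x assume x: "x \<in> carrier G"
      obtain k where k: "k \<in> carrier L" "d k = f x" using d_surj x by (metis f.hom_closed imageE)
      let ?u = "x \<otimes>\<^bsub>G\<^esub> inv\<^bsub>G\<^esub> (i (f x))"
      have "?u \<in> K" using x by (simp add: K_iff)
      then have "?u # k \<in> carrier ?S" using k by (simp add: semidirect_def)
      moreover have "x = ?e (?u # k)" using x k by (simp add: G.m_assoc)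
      ultimately show "x \<in> ?e ` carrier ?S" by blast
    qed
  qed
  ultimately show ?thesis using hom by (simp add: iso_iff)
qed

lemma group_semidirect:
  assumes d: "d \<in> iso L H" and L: "group L"
  shows "group (semidirect N L (\<lambda>k. cnj (i (d k))))"
proof -
  interpret L: group L by (rule L)
  have dc: "d k \<in> carrier H" if "k \<in> carrier L" for k
    using d that by (auto simp: iso_def hom_def)
  have "d \<one>\<^bsub>L\<^esub> = \<one>\<^bsub>H\<^esub>" using d L H.is_group by (auto simp: iso_def intro: hom_one)
  then show ?thesis
    by (intro G.group_if_iso[OF semidirect_iso[OF d]])
      (auto simp: semidirect_def cnj_def K_conj K_mult dc K_iff)
qed

end

section \<open>A criterion for the kernel to be free\<close>

context split_extension
begin

definition orbit :: "'a set \<Rightarrow> 'a set"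
  where "orbit S =
    {i g \<otimes>\<^bsub>G\<^esub> s \<otimes>\<^bsub>G\<^esub> inv\<^bsub>G\<^esub> (i g) | g s. g \<in> carrier H \<and> s \<in> S}"

lemma orbitI: "g \<in> carrier H \<Longrightarrow> s \<in> S \<Longrightarrow> i g \<otimes>\<^bsub>G\<^esub> s \<otimes>\<^bsub>G\<^esub> inv\<^bsub>G\<^esub> (i g) \<in> orbit S"
  by (auto simp: orbit_def)

lemma orbit_superset:
  assumes "S \<subseteq> carrier G"
  shows "S \<subseteq> orbit S"
proof
  fix s assume "s \<in> S"
  then show "s \<in> orbit S" using orbitI[of "\<one>\<^bsub>H\<^esub>" s S] assms by (auto simp: subset_iff)
qed

lemma orbit_conj:
  assumes S: "S \<subseteq> carrier G" and k: "k \<in> carrier H" and b: "b \<in> orbit S"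
  shows "i k \<otimes>\<^bsub>G\<^esub> b \<otimes>\<^bsub>G\<^esub> inv\<^bsub>G\<^esub> (i k) \<in> orbit S"
proof -
  obtain g s where g: "g \<in> carrier H" "s \<in> S" "b = i g \<otimes>\<^bsub>G\<^esub> s \<otimes>\<^bsub>G\<^esub> inv\<^bsub>G\<^esub> (i g)"
    using b by (auto simp: orbit_def)
  have "i k \<otimes>\<^bsub>G\<^esub> b \<otimes>\<^bsub>G\<^esub> inv\<^bsub>G\<^esub> (i k) =
      i (k \<otimes>\<^bsub>H\<^esub> g) \<otimes>\<^bsub>G\<^esub> s \<otimes>\<^bsub>G\<^esub> inv\<^bsub>G\<^esub> (i (k \<otimes>\<^bsub>H\<^esub> g))"
    using g k S by (auto simp: G.m_assoc G.inv_mult_group subset_iff)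
  then show ?thesis using orbitI[of "k \<otimes>\<^bsub>H\<^esub> g" s S] g k by simp
qed

lemma orbit_subset_K: "S \<subseteq> K \<Longrightarrow> orbit S \<subseteq> K"
  using K_conj by (auto simp: orbit_def)

text \<open>
  Every element of \<open>G\<close> is a product of conjugates times an element \<open>i g\<close> of the section, because the
  section normalizes the subgroup that the conjugates generate. On the kernel, \<open>g = 1\<close>.
\<close>

lemma kernel_subset_generate_orbit:
  assumes S: "S \<subseteq> K" and gen: "carrier G = generate G (S \<union> i ` carrier H)"
  shows "K \<subseteq> generate G (orbit S)"
proof
  have SG: "S \<subseteq> carrier G" using S K_closed by auto
  let ?B = "orbit S"
  have SB: "s \<in> ?B" if "s \<in> S" for s using orbit_superset[OF SG] that by auto
  have BG: "?B \<subseteq> carrier G" using orbit_subset_K[OF S] K_closed by auto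
  note gen_closed = G.generate_in_carrier[OF BG]
  have conj_gen: "i k \<otimes>\<^bsub>G\<^esub> u \<otimes>\<^bsub>G\<^esub> inv\<^bsub>G\<^esub> (i k) \<in> generate G ?B"
    if k: "k \<in> carrier H" and u: "u \<in> generate G ?B" for k u
    using BG u
  proof (induction rule: G.generate_left_induct)
    case one
    then show ?case using k by (simp add: generate.one)
  next
    case (step a s)
    have s: "s \<in> carrier G" and a: "a \<in> carrier G" using step BG gen_closed by auto
    have IH: "i k \<otimes>\<^bsub>G\<^esub> a \<otimes>\<^bsub>G\<^esub> inv\<^bsub>G\<^esub> (i k) \<in> generate G ?B" and "s \<in> ?B" using step by auto
    note cs = orbit_conj[OF SG k \<open>s \<in> ?B\<close>]
    have "i k \<otimes>\<^bsub>G\<^esub> (s \<otimes>\<^bsub>G\<^esub> a) \<otimes>\<^bsub>G\<^esub> inv\<^bsub>G\<^esub> (i k) =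
        (i k \<otimes>\<^bsub>G\<^esub> s \<otimes>\<^bsub>G\<^esub> inv\<^bsub>G\<^esub> (i k)) \<otimes>\<^bsub>G\<^esub> (i k \<otimes>\<^bsub>G\<^esub> a \<otimes>\<^bsub>G\<^esub> inv\<^bsub>G\<^esub> (i k))"
      using k s a by (simp add: G.m_assoc)
    moreover have "i k \<otimes>\<^bsub>G\<^esub> (inv\<^bsub>G\<^esub> s \<otimes>\<^bsub>G\<^esub> a) \<otimes>\<^bsub>G\<^esub> inv\<^bsub>G\<^esub> (i k) =
        inv\<^bsub>G\<^esub> (i k \<otimes>\<^bsub>G\<^esub> s \<otimes>\<^bsub>G\<^esub> inv\<^bsub>G\<^esub> (i k)) \<otimes>\<^bsub>G\<^esub> (i k \<otimes>\<^bsub>G\<^esub> a \<otimes>\<^bsub>G\<^esub> inv\<^bsub>G\<^esub> (i k))"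
      using k s a by (simp add: G.m_assoc G.inv_mult_group)
    ultimately show ?case
      using generate.eng[OF generate.incl[OF cs] IH] generate.eng[OF generate.inv[OF cs] IH]
      by (simp only: simp_thms)
  qed
  fix x assume x: "x \<in> K"
  have gens: "S \<union> i ` carrier H \<subseteq> carrier G" using SG by auto
  have "x \<in> generate G (S \<union> i ` carrier H)" using x gen K_closed by auto
  with gens have "\<exists>u g. u \<in> generate G ?B \<and> g \<in> carrier H \<and> x = u \<otimes>\<^bsub>G\<^esub> i g"
  proof (induction rule: G.generate_left_induct)
    case one
    show ?case by (rule exI[of _ "\<one>\<^bsub>G\<^esub>"], rule exI[of _ "\<one>\<^bsub>H\<^esub>"]) (simp add: generate.one)
  next
    case (step x c)
    then obtain u g where u: "u \<in> generate G ?B" and g: "g \<in> carrier H" and x: "x = u \<otimes>\<^bsub>G\<^esub> i g"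
      by blast
    note uc = gen_closed[OF u]
    from step consider "c \<in> S" | k where "k \<in> carrier H" "c = i k" by auto
    then show ?case
    proof cases
      case 1
      then have c: "c \<in> carrier G" "c \<in> ?B" using SG SB by auto
      have "c \<otimes>\<^bsub>G\<^esub> x = (c \<otimes>\<^bsub>G\<^esub> u) \<otimes>\<^bsub>G\<^esub> i g" "inv\<^bsub>G\<^esub> c \<otimes>\<^bsub>G\<^esub> x = (inv\<^bsub>G\<^esub> c \<otimes>\<^bsub>G\<^esub> u) \<otimes>\<^bsub>G\<^esub> i g"
        using c uc g by (simp_all add: x G.m_assoc)
      then show ?thesis
        using g generate.eng[OF generate.incl[OF c(2)] u] generate.eng[OF generate.inv[OF c(2)] u] by blast
    next
      case 2
      have *: "i l \<otimes>\<^bsub>G\<^esub> x = (i l \<otimes>\<^bsub>G\<^esub> u \<otimes>\<^bsub>G\<^esub> inv\<^bsub>G\<^esub> (i l)) \<otimes>\<^bsub>G\<^esub> i (l \<otimes>\<^bsub>H\<^esub> g)"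
        if "l \<in> carrier H" for l using that uc g by (simp add: x G.m_assoc)
      have "inv\<^bsub>G\<^esub> c = i (inv\<^bsub>H\<^esub> k)" using 2 by simp
      then show ?thesis
        using 2 *[of k] *[of "inv\<^bsub>H\<^esub> k"] conj_gen[OF _ u] g H.m_closed[of _ g] H.inv_closed[of k] by metis
    qed
  qed
  then obtain u g where u: "u \<in> generate G ?B" and g: "g \<in> carrier H" and xu: "x = u \<otimes>\<^bsub>G\<^esub> i g" by blast
  have "generate G ?B \<subseteq> K" by (rule G.generate_subgroup_incl[OF orbit_subset_K[OF S] f.subgroup_kernel])
  then have "f u = \<one>\<^bsub>H\<^esub>" "u \<in> carrier G" using u K_iff by auto
  then have "g = \<one>\<^bsub>H\<^esub>" using x xu g by (simp add: K_iff)
  then show "x \<in> generate G ?B" using xu u \<open>u \<in> carrier G\<close> by simp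
qed

text \<open>
  Let \<open>F\<close> be the free group on \<open>B\<close>, with the group \<open>H\<close> acting by conjugation of the letters through the
  section. If \<open>G\<close> maps to \<open>F \<rtimes> H\<close> in the expected way on \<open>S\<close> and on the section, then an element
  \<open>i g s (i g)\<^sup>-\<^sup>1\<close> of \<open>B\<close> goes to \<open>(1, g) (s, 1) (1, g)\<^sup>-\<^sup>1\<close>, which by definition of the action is the letter of
  that element. So the canonical map from \<open>F\<close> to the kernel has a left inverse. It is onto since the
  conjugates generate the kernel.
\<close>

lemma free_basis_kernel:
  assumes S: "S \<subseteq> K" and gen: "carrier G = generate G (S \<union> i ` carrier H)"
    and B: "B = orbit S"
    and lift: "\<And>\<phi>. group_action_by_homs (free_group B) H \<phi> \<Longrightarrow>
      (\<And>g b. g \<in> carrier H \<Longrightarrow> b \<in> B \<Longrightarrow>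
        \<phi> g (pres_class B {} [(b, True)]) =
          pres_class B {} [(i g \<otimes>\<^bsub>G\<^esub> b \<otimes>\<^bsub>G\<^esub> inv\<^bsub>G\<^esub> (i g), True)]) \<Longrightarrow>
      \<exists>\<psi> \<in> hom G (sdp (free_group B) H \<phi>).
        (\<forall>s\<in>S. \<psi> s = (pres_class B {} [(s, True)], \<one>\<^bsub>H\<^esub>)) \<and>
        (\<forall>g\<in>carrier H. \<psi> (i g) = (\<one>\<^bsub>free_group B\<^esub>, g))"
  shows "free_basis N B"
proof -
  interpret P: presentation B "{}" by unfold_locales auto
  interpret F: group "free_group B" unfolding free_group_def by (rule group_presented_group)
  have SG: "S \<subseteq> carrier G" using S K_closed by auto
  have BK: "B \<subseteq> K" using orbit_subset_K[OF S] B by simp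
  then have BG: "B \<subseteq> carrier G" using K_closed by auto
  have SB: "s \<in> B" if "s \<in> S" for s using orbit_superset[OF SG] that B by auto
  let ?c = "\<lambda>g b. i g \<otimes>\<^bsub>G\<^esub> b \<otimes>\<^bsub>G\<^esub> inv\<^bsub>G\<^esub> (i g)"
  have conj_conj: "?c k (?c g b) = ?c (k \<otimes>\<^bsub>H\<^esub> g) b"
    if "k \<in> carrier H" "g \<in> carrier H" "b \<in> carrier G" for k g b
    using that by (simp add: G.m_assoc G.inv_mult_group)
  have conjB: "?c k b \<in> B" if "k \<in> carrier H" "b \<in> B" for k b
    using orbit_conj[OF SG that(1)] that(2) B by simp
  have letter: "P.letter b \<in> carrier (free_group B)" if "b \<in> B" for b
    using P.letter_closed that by (auto simp: free_group_def)
  obtain \<phi> where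
    hom: "\<And>g. g \<in> carrier H \<Longrightarrow> \<phi> g \<in> hom (free_group B) (free_group B)"
    and val: "\<And>g b. g \<in> carrier H \<Longrightarrow> b \<in> B \<Longrightarrow> \<phi> g (P.letter b) = P.letter (?c g b)"
    and one: "\<And>a. a \<in> carrier (free_group B) \<Longrightarrow> \<phi> \<one>\<^bsub>H\<^esub> a = a"
    and mult: "\<And>g h a. g \<in> carrier H \<Longrightarrow> h \<in> carrier H \<Longrightarrow> a \<in> carrier (free_group B) \<Longrightarrow>
      \<phi> (g \<otimes>\<^bsub>H\<^esub> h) a = \<phi> g (\<phi> h a)"
  proof (rule P.presented_action_exists[OF H.is_group, of "\<lambda>g b. P.letter (?c g b)", folded free_group_def])
    show "\<exists>\<psi>\<in>hom (free_group B) (free_group B). \<forall>b\<in>B. \<psi> (P.letter b) = P.letter (?c g b)"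
      if g: "g \<in> carrier H" for g
    proof -
      obtain \<psi> where "\<psi> \<in> hom (free_group B) (free_group B)"
        "\<And>b. b \<in> B \<Longrightarrow> \<psi> (P.letter b) = P.letter (?c g b)"
        by (rule P.presented_hom_exists[OF F.is_group, of "\<lambda>b. P.letter (?c g b)", folded free_group_def])
          (use letter conjB[OF g] in auto)
      then show ?thesis by blast
    qed
    show "P.letter (?c \<one>\<^bsub>H\<^esub> b) = P.letter b" if "b \<in> B" for b
    proof -
      have "?c \<one>\<^bsub>H\<^esub> b = b" using that BG by (auto simp: subset_iff)
      then show ?thesis by simp
    qed
    show "\<psi> (P.letter (?c h b)) = P.letter (?c (g \<otimes>\<^bsub>H\<^esub> h) b)"
      if "g \<in> carrier H" "h \<in> carrier H" "b \<in> B" "\<And>b. b \<in> B \<Longrightarrow> \<psi> (P.letter b) = P.letter (?c g b)"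
      for g h b \<psi>
      unfolding that(4)[OF conjB[OF that(2,3)]] using that BG conj_conj[of g h b] by auto
  qed blast
  have act: "group_action_by_homs (free_group B) H \<phi>"
    by (intro group_action_by_homs.intro group_action_by_homs_axioms.intro F.is_group H.is_group)
      (simp_all add: hom one mult)
  interpret A: group_action_by_homs "free_group B" H \<phi> by (rule act)
  let ?T = "sdp (free_group B) H \<phi>"
  obtain \<psi> where \<psi>: "\<psi> \<in> hom G ?T" and \<psi>S: "\<And>s. s \<in> S \<Longrightarrow> \<psi> s = (P.letter s, \<one>\<^bsub>H\<^esub>)"
    and \<psi>i: "\<And>g. g \<in> carrier H \<Longrightarrow> \<psi> (i g) = (\<one>\<^bsub>free_group B\<^esub>, g)"
    using lift[OF act val] by blast
  interpret \<psi>: group_hom G ?T \<psi>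
    by (simp add: group_hom_def group_hom_axioms_def \<psi> G.is_group A.group_sdp)
  have \<psi>B: "\<psi> b = (P.letter b, \<one>\<^bsub>H\<^esub>)" if b: "b \<in> B" for b
  proof -
    obtain g s where g: "g \<in> carrier H" "s \<in> S" "b = ?c g s" using b by (auto simp: B orbit_def)
    have sG: "s \<in> carrier G" using g SG by auto
    \<comment> \<open>With the inverse inside the section, all three factors have known images.\<close>
    have "b = i g \<otimes>\<^bsub>G\<^esub> s \<otimes>\<^bsub>G\<^esub> i (inv\<^bsub>H\<^esub> g)" using g by simp
    then have "\<psi> b = (\<one>\<^bsub>free_group B\<^esub>, g) \<otimes>\<^bsub>?T\<^esub> (P.letter s, \<one>\<^bsub>H\<^esub>) \<otimes>\<^bsub>?T\<^esub> (\<one>\<^bsub>free_group B\<^esub>, inv\<^bsub>H\<^esub> g)"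
      using g sG \<psi>S[OF g(2)] \<psi>i[OF g(1)] \<psi>i[of "inv\<^bsub>H\<^esub> g"] by (simp del: i.hom_inv sdp_simps(2))
    also have "\<dots> = (\<phi> g (P.letter s), \<one>\<^bsub>H\<^esub>)"
      using g letter[OF SB[OF g(2)]] A.act_unit[OF g(1)] A.act_closed[OF g(1)] by simp
    also have "\<phi> g (P.letter s) = P.letter b" using val[OF g(1) SB[OF g(2)]] g(3) by simp
    finally show ?thesis .
  qed
  obtain h where h: "h \<in> hom (free_group B) N" and hB: "\<And>b. b \<in> B \<Longrightarrow> h (P.letter b) = b"
    by (rule P.presented_hom_exists[OF group_N, of "\<lambda>b. b", folded free_group_def]) (use BK in auto)
  interpret h: group_hom "free_group B" N h
    by (simp add: group_hom_def group_hom_axioms_def h F.is_group group_N)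
  have hG: "h \<in> hom (free_group B) G"
    using h K_closed by (auto simp: hom_def Pi_iff)
  have \<psi>h: "\<psi> (h a) = (a, \<one>\<^bsub>H\<^esub>)" if a: "a \<in> carrier (free_group B)" for a
  proof -
    have "(\<psi> \<circ> h) a = (a, \<one>\<^bsub>H\<^esub>)"
    proof (rule P.presented_hom_eq[OF A.group_sdp, folded free_group_def, OF _ A.sdp_incl_fst _ a])
      show "\<psi> \<circ> h \<in> hom (free_group B) ?T" using hG \<psi> by (rule hom_compose)
    qed (simp add: hB \<psi>B)
    then show ?thesis by simp
  qed
  have "inj_on h (carrier (free_group B))"
    by (rule inj_onI) (metis \<psi>h prod.inject)
  moreover have "h ` carrier (free_group B) = carrier N"
  proof
    show "h ` carrier (free_group B) \<subseteq> carrier N" using h by (auto simp: hom_def)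
    have "B \<subseteq> h ` carrier (free_group B)" using hB letter by (metis image_eqI subsetI)
    then have "generate N B \<subseteq> h ` carrier (free_group B)"
      by (rule group.generate_subgroup_incl[OF group_N _ h.img_is_subgroup])
    moreover have "generate N B = generate G B"
      by (rule G.generate_consistent[OF BK f.subgroup_kernel])
    ultimately show "carrier N \<subseteq> h ` carrier (free_group B)"
      using kernel_subset_generate_orbit[OF S gen] B by simp
  qed
  ultimately have "h \<in> iso (free_group B) N" using h by (simp add: iso_iff)
  then show ?thesis using hB BK by (auto simp: free_basis_def)
qed

end

section \<open>The iterated decomposition\<close>

lemma strand_split: "split_extension (PVT n) (PVT (n - 1)) (forget_strand n) (add_strand n)"
  by (intro split_extension.intro split_extension_axioms.intro PVT.is_group
      forget_strand_hom add_strand_hom forget_add_strand)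

interpretation strand: split_extension "PVT n" "PVT (n - 1)" "forget_strand n" "add_strand n"
  by (rule strand_split)

lemma U_eq_kernel: "m \<noteq> 2 \<Longrightarrow> U m = PVT m\<lparr>carrier := kernel (PVT m) (PVT (m - 1)) (forget_strand m)\<rparr>"
  by (simp add: U_def)

lemma conj_action_eq_cnj:
  assumes "m \<noteq> 2"
  shows "conj_action m = (\<lambda>k. strand.cnj m (add_strand m (decomp_eval (m - 1) k)))"
proof -
  have "carrier (U m) = kernel (PVT m) (PVT (m - 1)) (forget_strand m)"
    using assms by (simp add: U_eq_kernel)
  then show ?thesis by (intro ext) (simp only: conj_action_def strand.cnj_def)
qed

text \<open>
  Each step of the induction is \<open>semidirect_iso\<close> for the split extension that forgets strand \<open>m\<close>. That
  the iterated product is a group is carried along, since it provides the closure needed in the next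
  step.
\<close>

lemma decomp_eval_iso:
  assumes "2 \<le> m"
  shows "group (iterated_semidirect m) \<and> decomp_eval m \<in> iso (iterated_semidirect m) (PVT m)"
  using assms
proof (induction m rule: dec_induct)
  case base
  have e: "iterated_semidirect 2 = singleton_copy (PVT 2)"
    by (simp add: iterated_semidirect.simps U_def)
  have "bij_betw (decomp_eval 2) (carrier (singleton_copy (PVT 2))) (carrier (PVT 2))"
    by (rule bij_betw_byWitness[where f' = "\<lambda>u. [u]"]) (auto simp: singleton_copy_def)
  then have iso: "decomp_eval 2 \<in> iso (singleton_copy (PVT 2)) (PVT 2)"
    by (auto simp: iso_def hom_def singleton_copy_def)
  have "group (singleton_copy (PVT 2))"
    by (rule PVT.group_if_iso[OF iso]) (auto simp: singleton_copy_def)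
  then show ?case using iso by (simp add: e)
next
  case (step m)
  have m: "\<not> Suc m \<le> 2" "Suc m \<noteq> 2" "Suc m - 1 = m" using step.hyps by auto
  have "iterated_semidirect (Suc m) = semidirect (U (Suc m)) (iterated_semidirect m) (conj_action (Suc m))"
    using m by (subst iterated_semidirect.simps) simp
  then have e: "iterated_semidirect (Suc m) = semidirect (strand.N (Suc m)) (iterated_semidirect m)
      (\<lambda>k. strand.cnj (Suc m) (add_strand (Suc m) (decomp_eval m k)))"
    unfolding conj_action_eq_cnj[OF m(2)] U_eq_kernel[OF m(2)] m(3) .
  have d: "decomp_eval m \<in> iso (iterated_semidirect m) (PVT (Suc m - 1))" using step.IH m(3) by simp
  have iso: "(\<lambda>x. hd x \<otimes>\<^bsub>PVT (Suc m)\<^esub> add_strand (Suc m) (decomp_eval m (tl x)))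
      \<in> iso (iterated_semidirect (Suc m)) (PVT (Suc m))"
    unfolding e by (rule strand.semidirect_iso[OF d])
  have grp: "group (iterated_semidirect (Suc m))"
    unfolding e by (rule strand.group_semidirect[OF d]) (use step.IH in blast)
  have "decomp_eval (Suc m) x = hd x \<otimes>\<^bsub>PVT (Suc m)\<^esub> add_strand (Suc m) (decomp_eval m (tl x))"
    if "x \<in> carrier (iterated_semidirect (Suc m))" for x
    using that m by (auto simp: e semidirect_def)
  then have "decomp_eval (Suc m) \<in> iso (iterated_semidirect (Suc m)) (PVT (Suc m))"
    by (intro group.iso_eq[OF grp iso]) auto
  then show ?case using grp by blast
qed

section \<open>Freeness of the kernels\<close>

definition last_strand :: "nat \<Rightarrow> vt_elem set"
  where "last_strand n = lam n ` {p \<in> strand_pairs n. snd p = n}"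

lemma last_strand_kernel: "last_strand n \<subseteq> kernel (PVT n) (PVT (n - 1)) (forget_strand n)"
  by (auto simp: last_strand_def kernel_def lam_closed forget_strand_lam)

lemma PVT_generated_split:
  "carrier (PVT n) = generate (PVT n) (last_strand n \<union> add_strand n ` carrier (PVT (n - 1)))"
proof
  have sub: "last_strand n \<union> add_strand n ` carrier (PVT (n - 1)) \<subseteq> carrier (PVT n)"
    by (auto simp: last_strand_def lam_closed)
  then show "generate (PVT n) (last_strand n \<union> add_strand n ` carrier (PVT (n - 1))) \<subseteq> carrier (PVT n)"
    by (rule PVT.generate_incl)
  have "lam n p \<in> last_strand n \<union> add_strand n ` carrier (PVT (n - 1))" if p: "p \<in> strand_pairs n" for p
  proof (cases "snd p = n")
    case True
    then show ?thesis using p by (auto simp: last_strand_def)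
  next
    case False
    then have q: "p \<in> strand_pairs (n - 1)" using p by (cases p) (auto simp: strand_pairs_def)
    then have "lam n p = add_strand n (lam (n - 1) p)" by (rule add_strand_lam[symmetric])
    then show ?thesis using lam_closed[OF q] by auto
  qed
  then show "carrier (PVT n) \<subseteq> generate (PVT n) (last_strand n \<union> add_strand n ` carrier (PVT (n - 1)))"
    unfolding PVT_generated[of n] by (intro PVT.mono_generate) auto
qed

definition strand_basis :: "nat \<Rightarrow> vt_elem set"
  where "strand_basis n = strand.orbit n (last_strand n)"

text \<open>
  The map to \<open>F \<rtimes> PVT\<^sub>n\<^sub>-\<^sub>1\<close> is given on generators. The only relations to check are those between a
  \<open>\<lambda>\<^sub>k\<^sub>l\<close> with \<open>l < n\<close> and a \<open>\<lambda>\<^sub>i\<^sub>n\<close> with disjoint indices: there \<open>\<lambda>\<^sub>k\<^sub>l\<close> fixes \<open>\<lambda>\<^sub>i\<^sub>n\<close> under conjugation,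
  hence also its letter. Two generators \<open>\<lambda>\<^sub>i\<^sub>n\<close> and \<open>\<lambda>\<^sub>k\<^sub>n\<close> share the index \<open>n\<close>.
\<close>

lemma free_basis_strand:
  "free_basis (PVT n\<lparr>carrier := kernel (PVT n) (PVT (n - 1)) (forget_strand n)\<rparr>) (strand_basis n)"
proof (rule strand.free_basis_kernel[OF last_strand_kernel PVT_generated_split strand_basis_def])
  let ?B = "strand_basis n"
  let ?l = "\<lambda>b. pres_class ?B {} [(b, True)]"
  let ?c = "\<lambda>g b. add_strand n g \<otimes>\<^bsub>PVT n\<^esub> b \<otimes>\<^bsub>PVT n\<^esub> inv\<^bsub>PVT n\<^esub> (add_strand n g)"
  interpret P: presentation ?B "{}" by unfold_locales auto
  interpret F: group "free_group ?B" unfolding free_group_def by (rule group_presented_group)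
  fix \<phi> assume act: "group_action_by_homs (free_group ?B) (PVT (n - 1)) \<phi>"
    and \<phi>: "\<And>g b. g \<in> carrier (PVT (n - 1)) \<Longrightarrow> b \<in> ?B \<Longrightarrow> \<phi> g (?l b) = ?l (?c g b)"
  interpret A: group_action_by_homs "free_group ?B" "PVT (n - 1)" \<phi> by (rule act)
  let ?T = "sdp (free_group ?B) (PVT (n - 1)) \<phi>"
  have l: "?l b \<in> carrier (free_group ?B)" if "b \<in> ?B" for b
    using P.letter_closed that by (auto simp: free_group_def)
  have "last_strand n \<subseteq> carrier (PVT n)" by (auto simp: last_strand_def lam_closed)
  then have SB: "s \<in> ?B" if "s \<in> last_strand n" for s
    unfolding strand_basis_def using strand.orbit_superset that by blast
  have low: "p \<in> strand_pairs (n - 1)" if "p \<in> strand_pairs n" "snd p \<noteq> n" for p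
    using that by (cases p) (auto simp: strand_pairs_def)
  have last: "lam n p \<in> last_strand n" if "p \<in> strand_pairs n" "snd p = n" for p
    using that by (auto simp: last_strand_def)
  let ?y = "\<lambda>p. if snd p = n then (?l (lam n p), \<one>\<^bsub>PVT (n - 1)\<^esub>)
    else (\<one>\<^bsub>free_group ?B\<^esub>, lam (n - 1) p)"
  have mixed: "?y p \<otimes>\<^bsub>?T\<^esub> ?y q = ?y q \<otimes>\<^bsub>?T\<^esub> ?y p"
    if p: "p \<in> strand_pairs n" "snd p \<noteq> n" and q: "q \<in> strand_pairs n" "snd q = n"
      and d: "distinct [fst p, snd p, fst q, snd q]" for p q
  proof -
    have cl: "lam n p \<in> carrier (PVT n)" "lam n q \<in> carrier (PVT n)" using p q by (simp_all add: lam_closed)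
    have "lam n p \<otimes>\<^bsub>PVT n\<^esub> lam n q = lam n q \<otimes>\<^bsub>PVT n\<^esub> lam n p"
      by (rule lam_commute_PVT[of "fst p" "snd p" n "fst q" "snd q", unfolded prod.collapse, OF p(1) q(1) d])
    then have "?c (lam (n - 1) p) (lam n q) = lam n q"
      using cl unfolding add_strand_lam[OF low[OF p]] by (simp add: PVT.m_assoc)
    then have "\<phi> (lam (n - 1) p) (?l (lam n q)) = ?l (lam n q)"
      using \<phi>[OF lam_closed[OF low[OF p]] SB[OF last[OF q]]] by simp
    then show ?thesis
      using p q lam_closed[OF low[OF p]] l[OF SB[OF last[OF q]]] A.act_unit by simp
  qed
  obtain \<psi> where \<psi>: "\<psi> \<in> hom (PVT n) ?T" and \<psi>y: "\<And>p. p \<in> strand_pairs n \<Longrightarrow> \<psi> (lam n p) = ?y p"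
  proof (rule PVT_hom_exists[OF A.group_sdp, of n ?y])
    show "?y p \<in> carrier ?T" if "p \<in> strand_pairs n" for p
      using that l SB last low lam_closed[of p "n - 1"] by auto
    show "?y (i, j) \<otimes>\<^bsub>?T\<^esub> ?y (k, m) = ?y (k, m) \<otimes>\<^bsub>?T\<^esub> ?y (i, j)"
      if ij: "(i, j) \<in> strand_pairs n" and km: "(k, m) \<in> strand_pairs n" and d: "distinct [i, j, k, m]" for i j k m
    proof -
      consider "j \<noteq> n" "m \<noteq> n" | "j \<noteq> n" "m = n" | "j = n" "m \<noteq> n" using d by auto
      then show ?thesis
      proof cases
        case 1
        then have "(i, j) \<in> strand_pairs (n - 1)" "(k, m) \<in> strand_pairs (n - 1)"
          using low[OF ij] low[OF km] by auto
        then show ?thesis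
          using 1 d lam_commute_PVT[of i j "n - 1" k m] lam_closed A.act_unit by simp
      next
        case 2
        then show ?thesis using mixed[OF ij _ km] d by simp
      next
        case 3
        then show ?thesis using mixed[OF km _ ij] d by auto
      qed
    qed
  qed blast
  show "\<exists>\<psi>\<in>hom (PVT n) ?T. (\<forall>s\<in>last_strand n. \<psi> s = (?l s, \<one>\<^bsub>PVT (n - 1)\<^esub>)) \<and>
      (\<forall>g\<in>carrier (PVT (n - 1)). \<psi> (add_strand n g) = (\<one>\<^bsub>free_group ?B\<^esub>, g))"
  proof (intro bexI conjI ballI)
    show "\<psi> s = (?l s, \<one>\<^bsub>PVT (n - 1)\<^esub>)" if "s \<in> last_strand n" for s
      using that \<psi>y by (auto simp: last_strand_def)
    show "\<psi> (add_strand n g) = (\<one>\<^bsub>free_group ?B\<^esub>, g)" if g: "g \<in> carrier (PVT (n - 1))" for g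
    proof -
      have "(\<psi> \<circ> add_strand n) g = (\<one>\<^bsub>free_group ?B\<^esub>, g)"
      proof (rule PVT_hom_eq[OF A.group_sdp _ A.sdp_incl_snd _ g])
        show "\<psi> \<circ> add_strand n \<in> hom (PVT (n - 1)) ?T" using add_strand_hom \<psi> by (rule hom_compose)
        show "(\<psi> \<circ> add_strand n) (lam (n - 1) p) = (\<one>\<^bsub>free_group ?B\<^esub>, lam (n - 1) p)"
          if p: "p \<in> strand_pairs (n - 1)" for p
        proof -
          have "snd p \<noteq> n" using p by (auto simp: strand_pairs_def)
          then show ?thesis
            unfolding comp_apply add_strand_lam[OF p] \<psi>y[OF strand_pairs_pred[OF p]] by simp
        qed
      qed
      then show ?thesis by simp
    qed
  qed (rule \<psi>)
qed

text \<open>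
  Send \<open>\<lambda>\<^sub>1\<^sub>2\<close> to the shift of the integers, \<open>\<lambda>\<^sub>1\<^sub>n\<close> to the transposition \<open>(0 1)\<close> and all other generators to
  the identity. This respects the relations, as the two generators share the index \<open>1\<close>. The basis element
  \<open>\<lambda>\<^sub>1\<^sub>2\<^sup>m \<lambda>\<^sub>1\<^sub>n \<lambda>\<^sub>1\<^sub>2\<^sup>-\<^sup>m\<close> then becomes the transposition \<open>(m m+1)\<close>, so these elements are distinct.
\<close>

lemma infinite_strand_basis:
  assumes n: "3 \<le> n"
  shows "infinite (strand_basis n)"
proof -
  interpret Z: group "BijGroup (UNIV :: int set)" by (rule group_BijGroup)
  have Zmult: "x \<otimes>\<^bsub>BijGroup UNIV\<^esub> y = x \<circ> y" if "bij x" "bij y" for x y :: "int \<Rightarrow> int"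
    using that by (simp add: BijGroup_def Bij_def compose_def fun_eq_iff)
  have Zcarrier: "carrier (BijGroup (UNIV :: int set)) = {x. bij x}"
    by (auto simp: BijGroup_def Bij_def)
  have Zone: "\<one>\<^bsub>BijGroup (UNIV :: int set)\<^esub> = id"
    by (simp add: BijGroup_def fun_eq_iff)
  have bij_shift: "bij (\<lambda>x::int. x + c)" for c
    by (rule bij_betw_byWitness[where f' = "\<lambda>x. x - c"]) auto
  let ?y = "\<lambda>p::nat \<times> nat. if p = (1, 2) then (\<lambda>x::int. x + 1) else if p = (1, n) then transpose 0 1 else id"
  obtain \<theta> where \<theta>: "\<theta> \<in> hom (PVT n) (BijGroup (UNIV :: int set))"
    and \<theta>y: "\<And>p. p \<in> strand_pairs n \<Longrightarrow> \<theta> (lam n p) = ?y p"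
    by (rule PVT_hom_exists[OF Z.is_group, of n ?y])
      (auto simp: Zcarrier bij_shift Zmult n)
  interpret \<theta>: group_hom "PVT n" "BijGroup UNIV" \<theta>
    by (simp add: group_hom_def group_hom_axioms_def \<theta> PVT.is_group Z.is_group)
  have p12: "(1, 2) \<in> strand_pairs (n - 1)" "(1, 2) \<in> strand_pairs n" "(1, n) \<in> strand_pairs n"
    using n by (auto simp: strand_pairs_def)
  let ?a = "lam (n - 1) (1, 2)" and ?b = "lam n (1, n)"
  have a: "?a \<in> carrier (PVT (n - 1))" and b: "?b \<in> carrier (PVT n)" using p12 by (simp_all only: lam_closed)
  define g where "g m = ?a [^]\<^bsub>PVT (n - 1)\<^esub> (m::nat)" for m
  have g: "g m \<in> carrier (PVT (n - 1))" for m unfolding g_def using a by (rule PVT.nat_pow_closed)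
  have \<theta>g: "\<theta> (add_strand n (g m)) = (\<lambda>x. x + int m)" for m
  proof (induction m)
    case 0
    then show ?case by (simp add: g_def Zone fun_eq_iff del: One_nat_def)
  next
    case (Suc m)
    have "g (Suc m) = g m \<otimes>\<^bsub>PVT (n - 1)\<^esub> ?a" by (simp add: g_def)
    then have "add_strand n (g (Suc m)) = add_strand n (g m) \<otimes>\<^bsub>PVT n\<^esub> lam n (1, 2)"
      using strand.i.hom_mult[OF g[of m] a] add_strand_lam[OF p12(1)] by (simp only:)
    then have "\<theta> (add_strand n (g (Suc m))) = (\<lambda>x. x + int m) \<otimes>\<^bsub>BijGroup UNIV\<^esub> (\<lambda>x. x + 1)"
      using Suc g[of m] lam_closed[OF p12(2)] \<theta>y[OF p12(2)] by simp
    then show ?case by (simp add: Zmult bij_shift fun_eq_iff)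
  qed
  define c where "c m = add_strand n (g m) \<otimes>\<^bsub>PVT n\<^esub> ?b \<otimes>\<^bsub>PVT n\<^esub> inv\<^bsub>PVT n\<^esub> (add_strand n (g m))" for m
  have c_closed: "c m \<in> carrier (PVT n)" for m using g[of m] b by (simp add: c_def)
  have \<theta>c: "\<theta> (c m) (x + int m) = transpose 0 1 x + int m" for m x
  proof -
    \<comment> \<open>Comparing products avoids computing an inverse in the group of bijections.\<close>
    have "c m \<otimes>\<^bsub>PVT n\<^esub> add_strand n (g m) = add_strand n (g m) \<otimes>\<^bsub>PVT n\<^esub> ?b"
      using g[of m] b by (simp add: c_def PVT.m_assoc)
    then have "\<theta> (c m \<otimes>\<^bsub>PVT n\<^esub> add_strand n (g m)) = \<theta> (add_strand n (g m) \<otimes>\<^bsub>PVT n\<^esub> ?b)"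
      by (rule arg_cong)
    moreover have "\<theta> ?b = transpose 0 1" using \<theta>y[OF p12(3)] n by simp
    ultimately have "\<theta> (c m) \<otimes>\<^bsub>BijGroup UNIV\<^esub> (\<lambda>x. x + int m) =
        (\<lambda>x. x + int m) \<otimes>\<^bsub>BijGroup UNIV\<^esub> transpose 0 1"
      using \<theta>.hom_mult[OF c_closed strand.i.hom_closed[OF g]] \<theta>.hom_mult[OF strand.i.hom_closed[OF g] b]
      by (simp only: \<theta>g)
    moreover have "bij (\<theta> (c m))" using \<theta>.hom_closed[OF c_closed] by (simp add: Zcarrier)
    ultimately show ?thesis by (simp add: Zmult bij_shift fun_eq_iff)
  qed
  have "c k \<noteq> c m" if "k < m" for k m
  proof
    assume "c k = c m"
    then have "transpose 0 1 0 + int k = transpose 0 1 (int k - int m) + int m"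
      using \<theta>c[of k 0] \<theta>c[of m "int k - int m"] by simp
    then show False using that by (simp add: transpose_def)
  qed
  then have "inj c" by (metis injI linorder_neqE_nat)
  moreover have "?b \<in> last_strand n" using p12(3) by (auto simp: last_strand_def)
  then have "range c \<subseteq> strand_basis n" unfolding c_def strand_basis_def using g strand.orbitI by blast
  ultimately show ?thesis by (meson finite_imageD finite_subset infinite_UNIV_nat)
qed

lemma U_free: "3 \<le> i \<Longrightarrow> free_of_infinite_rank (U i)"
  unfolding free_of_infinite_rank_def
  using strand.group_N free_basis_strand infinite_strand_basis U_eq_kernel[of i] by fastforce

lemma PVT_2_infinite_cyclic: "PVT 2 \<cong> integer_group"
proof -
  have pairs: "strand_pairs 2 = {(1, 2)}" by (auto simp: strand_pairs_def)
  let ?a = "lam 2 (1, 2)"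
  have a: "?a \<in> carrier (PVT 2)" by (rule lam_closed) (simp add: pairs)
  obtain h where h: "h \<in> hom (PVT 2) integer_group" and ha: "h ?a = 1"
    by (rule PVT_hom_exists[OF group_integer_group, of 2 "\<lambda>_. 1"]) (auto simp: pairs)
  interpret h: group_hom "PVT 2" integer_group h
    by (simp add: group_hom_def group_hom_axioms_def h PVT.is_group)
  have pow: "h (?a [^]\<^bsub>PVT 2\<^esub> k) = k" for k :: int
    using h.hom_int_pow[OF a, of k] ha by simp
  have all: "\<exists>k::int. x = ?a [^]\<^bsub>PVT 2\<^esub> k" if "x \<in> carrier (PVT 2)" for x
    using that PVT.generate_pow[OF a] PVT_generated[of 2] by (auto simp: pairs)
  have "h \<in> iso (PVT 2) integer_group"
    unfolding h.iso_iff
  proof (intro conjI ballI impI)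
    show "carrier integer_group \<subseteq> h ` carrier (PVT 2)"
      using pow PVT.int_pow_closed[OF a] by (metis image_eqI subsetI)
    show "x = \<one>\<^bsub>PVT 2\<^esub>" if "x \<in> carrier (PVT 2)" "h x = \<one>\<^bsub>integer_group\<^esub>" for x
      using all[OF that(1)] that(2) pow by auto
  qed
  then show ?thesis by (rule is_isoI)
qed

theorem theorem4p1:
  fixes n :: nat
  assumes "n \<ge> 2"
  shows "PVT n \<cong> iterated_semidirect n
    \<and> (\<forall>m\<in>{3..n}. conj_action m \<in> hom (iterated_semidirect (m - 1)) (AutoGroup (U m)))
    \<and> U 2 = PVT 2 \<and> PVT 2 \<cong> integer_group
    \<and> (\<forall>i\<ge>3. free_of_infinite_rank (U i))"
proof (intro conjI ballI allI impI)
  show "conj_action m \<in> hom (iterated_semidirect (m - 1)) (AutoGroup (U m))" if "m \<in> {3..n}" for m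
  proof -
    have m: "m \<noteq> 2" "2 \<le> m - 1" using that by auto
    have "decomp_eval (m - 1) \<in> hom (iterated_semidirect (m - 1)) (PVT (m - 1))"
      using decomp_eval_iso[OF m(2)] by (simp add: iso_def del: One_nat_def)
    from strand.conj_action_hom[OF this] show ?thesis
      unfolding conj_action_eq_cnj[OF m(1)] U_eq_kernel[OF m(1)] .
  qed
  show "U 2 = PVT 2" by (simp add: U_def)
  show "PVT n \<cong> iterated_semidirect n"
    using decomp_eval_iso[OF assms] by (meson group.iso_sym is_isoI)
qed (simp_all add: PVT_2_infinite_cyclic U_free)

end
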